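(* There exist a finitely generated group $\Delta$ and a symmetric finitely supported probability measure $\mu'$ on $\Delta$ (with support generating $\Delta$) such that, for the random walk $Y_n$ with step law $\mu'$ started at the identity and $\|\cdot\|$ a word norm on $\Delta$ with respect to a finite generating set, $$\liminf_n\frac{\log|\log P(Y_n=1)|}{\log n}=\frac13,\quad \limsup_n\frac{\log|\log P(Y_n=1)|}{\log n}=1,$$ $$\liminf_n\frac{\log \mathbb{E}\|Y_n\|}{\log n}=\frac12,\quad \limsup_n\frac{\log \mathbb{E}\|Y_n\|}{\log n}=1.$$
   Context: $Y_n$ denotes the random walk on $\Delta$ whose increments are i.i.d. with law $\mu'$, started at the identity, so $Y_n$ has law $\mu'^{*n}$. *)

theory Defs
  imports "HOL-Probability.Probability" "HOL-Algebra.Algebra"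
begin

primrec rw_law :: "('a, 'b) monoid_scheme \<Rightarrow> 'a pmf \<Rightarrow> nat \<Rightarrow> 'a pmf" where
  "rw_law G \<mu> 0 = return_pmf \<one>\<^bsub>G\<^esub>"
| "rw_law G \<mu> (Suc n) = bind_pmf (rw_law G \<mu> n) (\<lambda>y. map_pmf (\<lambda>s. y \<otimes>\<^bsub>G\<^esub> s) \<mu>)"

definition word_norm :: "('a, 'b) monoid_scheme \<Rightarrow> 'a set \<Rightarrow> 'a \<Rightarrow> nat" where
  "word_norm G T x = (LEAST n. \<exists>w. length w = n \<and> set w \<subseteq> T \<union> m_inv G ` T
        \<and> foldr (mult G) w \<one>\<^bsub>G\<^esub> = x)"

end

(*
The group is a limit of a sequence of marked groups that alternates between two behaviours.

Small groups are extensions of the lamplighter group with three lamps Z/2 per site by a finite kernel.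
For them the walk confined to [-r, r] reaches only exp(O(r)) elements, so the return probability is at
least exp(-C n^(1/3)), and the norm is bounded by the range of the cursor, hence of order n^(1/2) up to
a logarithm.  The lamplighter group is a quotient of all groups involved and gives the matching bounds.

Large groups replace the three commuting lamps by generators of Z/2 * Z/2 * Z/2 placed at offsets
-k, 0, k.  Ping-pong on the lamp state gives a spectral gap in l^2, hence exponential decay of all
transition probabilities and linear speed.  Words that are short compared with k do not distinguish
this group from the lamplighter group.

The large groups are residually finite relative to the lamplighter group: making the positions periodic
and truncating the tree of Z/2 * Z/2 * Z/2 yields small groups that agree with them on large balls.
Hence one can alternate: return probability and speed at time n only depend on words of length 2n, so
every small group can be modified outside of a large ball to look large at some later time, and then
again small at some still later time.
*)
theory Submission
  imports Defs "HOL-Real_Asymp.Real_Asymp"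
begin

text \<open>The obstacle is reversibility: over the lamplighter group a large group has an infinite
  kernel, and any group mapping onto it has exponentially small return probability at all late
  times. Large groups therefore never occur as stages; each enters only through a small group that
  agrees with it on a ball. Small groups must in turn be closed under this operation, which is why
  they are defined by a finite kernel and not by their asymptotics. The limit is an intersection of
  decreasing congruences on words. Every stage and the limit stay finer than the lamplighter
  congruence and inherit its bounds at all times, while agreement on balls preserves what was
  achieved at the chosen times. The exponents ignore constants, so no estimate has to be uniform in
  the stage: each time is chosen after the group to which it belongs. The value 1/3 comes from
  balancing the cost n / r^2 of confining the cursor to [-r, r] against the O(r) lamps within its
  reach.\<close>

text \<open>The letter \<open>(i, m, j)\<close> toggles lamp \<open>i\<close>, moves the cursor by \<open>mv m\<close> and toggles
  lamp \<open>j\<close>, where \<open>None\<close> stands for no toggle. Toggling both before and after the move makes the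
  set of letters symmetric and randomizes every visited lamp.\<close>

type_synonym idx = "bool option"
type_synonym letter = "idx option \<times> idx \<times> idx option"
type_synonym word = "letter list"

fun mv :: "idx \<Rightarrow> int" where
  "mv None = 0"
| "mv (Some b) = (if b then 1 else - 1)"

fun linv :: "letter \<Rightarrow> letter" where
  "linv (i, m, j) = (j, map_option Not m, i)"

definition winv :: "word \<Rightarrow> word" where
  "winv w = rev (map linv w)"

definition disp :: "word \<Rightarrow> int" where
  "disp w = (\<Sum>(i, m, j)\<leftarrow>w. mv m)"

lemma UNIV_idx: "(UNIV :: idx set) = {None, Some True, Some False}"
  by (auto simp: UNIV_option_conv UNIV_bool)

lemma mv_inverse [simp]: "mv (map_option Not m) = - mv m"
  by (cases m) auto

lemma abs_mv_le: "\<bar>mv m\<bar> \<le> 1"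
  by (cases m) auto

lemma mv_inj: "mv m = mv m' \<longleftrightarrow> m = m'"
  by (cases m; cases m') auto

lemma linv_linv [simp]: "linv (linv l) = l"
  by (cases l) (auto simp: option.map_comp comp_def option.map_ident)

lemma bij_linv: "bij linv"
  by (rule involuntory_imp_bij) simp

lemma winv_winv [simp]: "winv (winv w) = w"
  by (simp add: winv_def rev_map comp_def)

lemma winv_Nil [simp]: "winv [] = []"
  by (simp add: winv_def)

lemma winv_Cons: "winv (l # w) = winv w @ [linv l]"
  by (simp add: winv_def)

lemma length_winv [simp]: "length (winv w) = length w"
  by (simp add: winv_def)

lemma disp_Nil [simp]: "disp [] = 0"
  by (simp add: disp_def)

lemma disp_Cons: "disp (l # w) = mv (fst (snd l)) + disp w"
  by (simp add: disp_def case_prod_beta)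

lemma disp_append [simp]: "disp (w @ v) = disp w + disp v"
  by (simp add: disp_def)

lemma disp_winv [simp]: "disp (winv w) = - disp w"
  by (induction w) (auto simp: winv_Cons disp_Cons)

lemma abs_disp_le: "\<bar>disp w\<bar> \<le> int (length w)"
proof (induction w)
  case (Cons l w)
  then show ?case using abs_mv_le[of "fst (snd l)"] by (simp add: disp_Cons)
qed simp

section \<open>Marked groups\<close>

text \<open>A group with generators marked by the letters is a congruence on words: it
  identifies the words that represent the same group element.\<close>

definition marked :: "(word \<Rightarrow> word \<Rightarrow> bool) \<Rightarrow> bool" where
  "marked R \<longleftrightarrow> equivp R \<and> (\<forall>w w' v v'. R w w' \<longrightarrow> R v v' \<longrightarrow> R (w @ v) (w' @ v'))
     \<and> (\<forall>w. R (w @ winv w) []) \<and> R [(None, None, None)] []"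

text \<open>The bound is on the total length because \<open>R w v\<close> amounts to
  \<open>R (w @ winv v) []\<close>; agreement then only has to be checked for which words are
  trivial.\<close>

definition agree :: "nat \<Rightarrow> (word \<Rightarrow> word \<Rightarrow> bool) \<Rightarrow> (word \<Rightarrow> word \<Rightarrow> bool) \<Rightarrow> bool" where
  "agree m R R' \<longleftrightarrow> (\<forall>w v. length w + length v \<le> m \<longrightarrow> R w v = R' w v)"

definition mnorm :: "(word \<Rightarrow> word \<Rightarrow> bool) \<Rightarrow> word \<Rightarrow> nat" where
  "mnorm R w = (LEAST n. \<exists>v. length v = n \<and> R v w)"

lemma marked_refl: "marked R \<Longrightarrow> R w w"
  and marked_sym: "marked R \<Longrightarrow> R w v \<Longrightarrow> R v w"
  and marked_trans: "marked R \<Longrightarrow> R w v \<Longrightarrow> R v u \<Longrightarrow> R w u"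
  and marked_append: "marked R \<Longrightarrow> R w w' \<Longrightarrow> R v v' \<Longrightarrow> R (w @ v) (w' @ v')"
  and marked_winv: "marked R \<Longrightarrow> R (w @ winv w) []"
  and marked_id: "marked R \<Longrightarrow> R [(None, None, None)] []"
  unfolding marked_def by (blast intro: equivp_reflp dest: equivp_symp equivp_transp)+

lemma marked_winv': "marked R \<Longrightarrow> R (winv w @ w) []"
  using marked_winv[of R "winv w"] by simp

lemma markedI:
  assumes "\<And>w. R w w" "\<And>w v. R w v \<Longrightarrow> R v w" "\<And>w v u. R w v \<Longrightarrow> R v u \<Longrightarrow> R w u"
    and "\<And>w w' v v'. R w w' \<Longrightarrow> R v v' \<Longrightarrow> R (w @ v) (w' @ v')" "\<And>w. R (w @ winv w) []"
    and "R [(None, None, None)] []"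
  shows "marked R"
proof -
  have "equivp R"
    by (intro equivpI reflpI sympI transpI) (fact assms(1), erule assms(2), erule (1) assms(3))
  then show ?thesis
    unfolding marked_def using assms(4-6) by blast
qed

lemma marked_iff: assumes M: "marked R" shows "R w v \<longleftrightarrow> R (w @ winv v) []"
proof
  assume "R w v"
  then have "R (w @ winv v) (v @ winv v)"
    by (rule marked_append[OF M]) (rule marked_refl[OF M])
  then show "R (w @ winv v) []"
    by (rule marked_trans[OF M]) (rule marked_winv[OF M])
next
  assume "R (w @ winv v) []"
  then have "R ((w @ winv v) @ v) ([] @ v)"
    by (rule marked_append[OF M]) (rule marked_refl[OF M])
  then have 1: "R (w @ winv v @ v) v" by simp
  have "R (w @ (winv v @ v)) (w @ [])"
    by (intro marked_append[OF M] marked_refl[OF M] marked_winv'[OF M])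
  then have "R w (w @ winv v @ v)" using marked_sym[OF M] by simp
  from this 1 show "R w v" by (rule marked_trans[OF M])
qed

lemma agreeI:
  assumes "marked R" "marked R'" "\<And>w. length w \<le> m \<Longrightarrow> R w [] \<longleftrightarrow> R' w []"
  shows "agree m R R'"
  unfolding agree_def
proof (intro allI impI)
  fix w v :: word assume "length w + length v \<le> m"
  then have "R (w @ winv v) [] \<longleftrightarrow> R' (w @ winv v) []" by (intro assms(3)) simp
  then show "R w v = R' w v"
    using marked_iff[OF assms(1)] marked_iff[OF assms(2)] by simp
qed

lemma agree_mono: "agree m R R' \<Longrightarrow> k \<le> m \<Longrightarrow> agree k R R'"
  by (auto simp: agree_def)

lemma marked_conj:
  "marked R \<Longrightarrow> marked R' \<Longrightarrow> marked (\<lambda>w v. R w v \<and> R' w v)"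
  by (rule markedI)
    (simp add: marked_refl, simp add: marked_sym,
      meson marked_trans, simp add: marked_append, simp add: marked_winv,
      simp add: marked_id)

lemma marked_all:
  "(\<And>i. marked (R i)) \<Longrightarrow> marked (\<lambda>w v. \<forall>i. R i w v)"
  by (rule markedI)
    (simp add: marked_refl, simp add: marked_sym,
      meson marked_trans, simp add: marked_append, simp add: marked_winv,
      simp add: marked_id)

lemma mnorm_witness: assumes "marked R" shows "\<exists>v. length v = mnorm R w \<and> R v w"
  unfolding mnorm_def by (rule LeastI_ex) (use marked_refl[OF assms] in blast)

lemma mnorm_le: "R v w \<Longrightarrow> mnorm R w \<le> length v"
  unfolding mnorm_def by (rule Least_le) blast

lemma mnorm_le_length: "marked R \<Longrightarrow> mnorm R w \<le> length w"
  by (rule mnorm_le) (rule marked_refl)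

text \<open>A shortest representative of \<open>w\<close> is no longer than \<open>w\<close>, so
  only relations of total length at most \<open>2 * length w\<close> are consulted.\<close>

lemma agree_mnorm:
  assumes "agree (2 * length w) R R'" "marked R" "marked R'"
  shows "mnorm R w = mnorm R' w"
proof (rule antisym)
  obtain v where "length v = mnorm R' w" "R' v w" using mnorm_witness assms by blast
  then show "mnorm R w \<le> mnorm R' w"
    using assms mnorm_le[of R v w] mnorm_le_length[of R' w] by (auto simp: agree_def)
next
  obtain v where "length v = mnorm R w" "R v w" using mnorm_witness assms by blast
  then show "mnorm R' w \<le> mnorm R w"
    using assms mnorm_le[of R' v w] mnorm_le_length[of R w] by (auto simp: agree_def)
qed

section \<open>Averages over words\<close>

text \<open>There are 48 = 4 * 3 * 4 letters, so this is the expectation of \<open>f\<close> over a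
  uniformly random word, that is, over the increments of the walk.\<close>

definition avg :: "nat \<Rightarrow> (word \<Rightarrow> real) \<Rightarrow> real" where
  "avg n f = (\<Sum>w | length w = n. f w) / 48 ^ n"

definition ret :: "(word \<Rightarrow> word \<Rightarrow> bool) \<Rightarrow> nat \<Rightarrow> real" where
  "ret R n = avg n (\<lambda>w. of_bool (R w []))"

definition speed :: "(word \<Rightarrow> word \<Rightarrow> bool) \<Rightarrow> nat \<Rightarrow> real" where
  "speed R n = avg n (\<lambda>w. real (mnorm R w))"

lemma card_letter: "CARD(letter) = 48"
  by (simp add: card_prod card_option)

lemma finite_words: "finite {w :: word. length w = n}"
  using finite_lists_length_eq[of "UNIV :: letter set" n] by simp

lemma card_words: "card {w :: word. length w = n} = 48 ^ n"
  using card_lists_length_eq[of "UNIV :: letter set" n] by (simp add: card_letter)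

lemma words_Suc: "{w. length w = Suc n} = (\<lambda>(w, l). w @ [l]) ` ({w. length w = n} \<times> UNIV)"
proof (intro Set.set_eqI iffI)
  fix w :: "'a list" assume "w \<in> {w. length w = Suc n}"
  then obtain v l where "w = v @ [l]" "length v = n"
    by (cases w rule: rev_cases) auto
  then show "w \<in> (\<lambda>(w, l). w @ [l]) ` ({w. length w = n} \<times> UNIV)" by auto
qed auto

lemma sum_words_Suc:
  "(\<Sum>w | length w = Suc n. f w) = (\<Sum>w | length w = n. \<Sum>l\<in>UNIV. f (w @ [l :: letter]))"
proof -
  have "inj_on (\<lambda>(w, l). w @ [l]) ({w. length w = n} \<times> (UNIV :: letter set))"
    by (auto simp: inj_on_def)
  then show ?thesis
    unfolding words_Suc by (subst sum.reindex) (auto simp: sum.cartesian_product case_prod_beta comp_def)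
qed

lemma avg_0 [simp]: "avg 0 f = f []"
  by (simp add: avg_def)

lemma avg_Suc: "avg (Suc n) f = avg n (\<lambda>w. (\<Sum>l\<in>UNIV. f (w @ [l])) / 48)"
  by (simp add: avg_def sum_words_Suc sum_divide_distrib[symmetric] mult.commute)

lemma avg_add: "avg n (\<lambda>w. f w + g w) = avg n f + avg n g"
  by (simp add: avg_def sum.distrib add_divide_distrib)

lemma avg_diff: "avg n (\<lambda>w. f w - g w) = avg n f - avg n g"
  by (simp add: avg_def sum_subtractf diff_divide_distrib)

lemma avg_cmult: "avg n (\<lambda>w. c * f w) = c * avg n f"
  by (simp add: avg_def sum_distrib_left)

lemma avg_const: "avg n (\<lambda>w. c) = c"
  by (simp add: avg_def card_words)

lemma avg_sum: "avg n (\<lambda>w. \<Sum>i\<in>A. f i w) = (\<Sum>i\<in>A. avg n (f i))"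
  unfolding avg_def by (subst sum.swap) (simp add: sum_divide_distrib)

lemma avg_mono: "(\<And>w. length w = n \<Longrightarrow> f w \<le> g w) \<Longrightarrow> avg n f \<le> avg n g"
  unfolding avg_def by (intro divide_right_mono sum_mono) auto

lemma avg_cong: "(\<And>w. length w = n \<Longrightarrow> f w = g w) \<Longrightarrow> avg n f = avg n g"
  unfolding avg_def by (auto intro!: sum.cong)

lemma avg_nonneg: "(\<And>w. length w = n \<Longrightarrow> 0 \<le> f w) \<Longrightarrow> 0 \<le> avg n f"
  unfolding avg_def by (auto intro!: sum_nonneg divide_nonneg_nonneg)

lemma avg_winv: "avg n (\<lambda>w. f (winv w)) = avg n f"
proof -
  have "bij_betw winv {w. length w = n} {w. length w = n}"
    by (rule bij_betw_byWitness[where f' = winv]) auto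
  then show ?thesis unfolding avg_def by (simp add: sum.reindex_bij_betw)
qed

lemma avg_append: "avg (m + n) f = avg m (\<lambda>w. avg n (\<lambda>v. f (w @ v)))"
proof (induction n arbitrary: f)
  case (Suc n)
  show ?case using Suc[of "\<lambda>w. (\<Sum>l\<in>UNIV. f (w @ [l])) / 48"] by (simp add: avg_Suc)
qed simp

lemma sum_letter:
  "(\<Sum>l\<in>UNIV. f l) = (\<Sum>i\<in>UNIV. \<Sum>m\<in>UNIV. \<Sum>j\<in>UNIV. f ((i, m, j) :: letter))"
  by (simp add: sum.cartesian_product case_prod_beta)

lemma sum_letter_mv:
  "(\<Sum>l\<in>UNIV. f (mv (fst (snd (l :: letter))))) / 48 = (f 0 + f 1 + f (- 1)) / (3 :: real)"
  by (simp add: sum_letter card_option UNIV_idx)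

lemma agree_ret: "agree m R R' \<Longrightarrow> n \<le> m \<Longrightarrow> ret R n = ret R' n"
  unfolding ret_def by (intro avg_cong) (auto simp: agree_def)

lemma agree_speed:
  "agree m R R' \<Longrightarrow> marked R \<Longrightarrow> marked R' \<Longrightarrow> 2 * n \<le> m \<Longrightarrow> speed R n = speed R' n"
  unfolding speed_def by (intro avg_cong) (metis agree_mono agree_mnorm)

lemma ret_mono: "(\<And>w v. R w v \<Longrightarrow> R' w v) \<Longrightarrow> ret R n \<le> ret R' n"
  unfolding ret_def by (intro avg_mono) auto

lemma speed_le: "marked R \<Longrightarrow> speed R n \<le> n"
  using avg_mono[of n "\<lambda>w. real (mnorm R w)" "\<lambda>_. real n"] mnorm_le_length[of R]
  unfolding speed_def by (fastforce simp: avg_const)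

section \<open>Lamps\<close>

definition firing :: "(idx \<Rightarrow> int \<Rightarrow> bool) \<Rightarrow> int \<Rightarrow> idx option \<Rightarrow> idx list" where
  "firing F x a = (case a of None \<Rightarrow> [] | Some i \<Rightarrow> if F i x then [i] else [])"

text \<open>A fibre that starts at position \<open>x\<close> relative to the cursor is carried along by the moves of the
  word; \<open>F i z\<close> decides whether toggling lamp \<open>i\<close> affects the fibre when it is at position \<open>z\<close>.\<close>

fun fired :: "(idx \<Rightarrow> int \<Rightarrow> bool) \<Rightarrow> word \<Rightarrow> int \<Rightarrow> idx list" where
  "fired F [] x = []"
| "fired F ((i, m, j) # w) x = firing F x i @ firing F (x + mv m) j @ fired F w (x + mv m)"

lemma fired_append: "fired F (w @ v) x = fired F w x @ fired F v (x + disp w)"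
  by (induction F w x rule: fired.induct) (auto simp: disp_Cons add.assoc)

lemma rev_firing [simp]: "rev (firing F x a) = firing F x a"
  by (auto simp: firing_def split: option.splits)

text \<open>The inverse word carries the fibre back along the same positions, so the same lamps fire
  in reverse order. Since toggles are involutions, everything cancels, which gives inverses in all
  groups below.\<close>

lemma fired_winv: "fired F (winv w) (x + disp w) = rev (fired F w x)"
proof (induction F w x rule: fired.induct)
  case (2 F i m j w x)
  then show ?case by (simp add: winv_Cons fired_append disp_Cons add.assoc)
qed simp

lemma length_firing: "length (firing F x a) \<le> 1"
  by (auto simp: firing_def split: option.splits)

lemma length_fired: "length (fired F w x) \<le> 2 * length w"
proof (induction F w x rule: fired.induct)
  case (2 F i m j w x)
  then show ?case using length_firing[of F x i] length_firing[of F "x + mv m" j] by simp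
qed simp

lemma firing_cong: "(\<And>i. F i x = G i y) \<Longrightarrow> firing F x a = firing G y a"
  by (auto simp: firing_def split: option.splits)

text \<open>A fibre moves by at most one per letter, so only positions within
  \<open>length w\<close> of its start matter. The two starts \<open>x\<close> and \<open>y\<close>
  may differ, which allows windows to be translated.\<close>

lemma fired_cong:
  assumes "\<And>i s. \<bar>s\<bar> \<le> int (length w) \<Longrightarrow> F i (x + s) = G i (y + s)"
  shows "fired F w x = fired G w y"
  using assms
proof (induction w arbitrary: x y)
  case (Cons l w)
  obtain i m j where l: "l = (i, m, j)" by (cases l)
  note m = abs_mv_le[of m]
  have "fired F w (x + mv m) = fired G w (y + mv m)"
  proof (rule Cons.IH)
    fix i' :: idx and s :: int assume "\<bar>s\<bar> \<le> int (length w)"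
    with m show "F i' (x + mv m + s) = G i' (y + mv m + s)"
      using Cons.prems[of "mv m + s" i'] by (simp add: add.assoc)
  qed
  moreover have "firing F x i = firing G y i"
    using Cons.prems[of 0] by (intro firing_cong) simp
  moreover have "firing F (x + mv m) j = firing G (y + mv m) j"
    using Cons.prems[of "mv m"] m by (intro firing_cong) simp
  ultimately show ?case by (simp add: l)
qed simp

lemma fired_False: "fired (\<lambda>_ _. False) w x = []"
  by (induction "\<lambda>(_ :: idx) (_ :: int). False" w x rule: fired.induct)
    (auto simp: firing_def split: option.splits)

lemma set_fired: "set (fired F w x) \<subseteq> {i. \<exists>z. F i z}"
  by (induction F w x rule: fired.induct) (auto simp: firing_def split: option.splits if_splits)

section \<open>The lamplighter group\<close>

text \<open>The fibre \<open>x\<close> is hit when \<open>x + disp = 0\<close>, so in absolute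
  coordinates it is the lamp at position \<open>- x\<close>; this explains the minus signs
  below.\<close>

definition lampcount :: "idx \<Rightarrow> word \<Rightarrow> int \<Rightarrow> nat" where
  "lampcount i w x = length (fired (\<lambda>i' z. i' = i \<and> z = 0) w x)"

definition lamplighter :: "word \<Rightarrow> word \<Rightarrow> bool" where
  "lamplighter w v \<longleftrightarrow> disp w = disp v \<and> (\<forall>i x. even (lampcount i w x) = even (lampcount i v x))"

lemma lampcount_append: "lampcount i (w @ v) x = lampcount i w x + lampcount i v (x + disp w)"
  by (simp add: lampcount_def fired_append)

lemma lampcount_Nil [simp]: "lampcount i [] x = 0"
  by (simp add: lampcount_def)

lemma marked_lamplighter: "marked lamplighter"
proof (rule markedI)
  fix w show "lamplighter (w @ winv w) []"
    by (auto simp: lamplighter_def lampcount_append) (simp_all add: lampcount_def fired_winv)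
next
  show "lamplighter [(None, None, None)] []"
    by (simp add: lamplighter_def disp_Cons lampcount_def firing_def)
qed (auto simp: lamplighter_def lampcount_append)

section \<open>Lamps in a free product of involutions\<close>

text \<open>On lists without equal neighbours this is left multiplication by a generator of
  \<open>Z\<^sub>2 * Z\<^sub>2 * Z\<^sub>2\<close>; counting the leading occurrences modulo 2 makes it an involution of all lists.
  Freezing it outside of a finite set \<open>D\<close> gives the finite quotients.\<close>

definition flip :: "idx \<Rightarrow> idx list \<Rightarrow> idx list" where
  "flip i y = (if odd (length (takeWhile ((=) i) y)) then tl y else i # y)"

definition toggle :: "idx list set \<Rightarrow> idx \<Rightarrow> idx list \<Rightarrow> idx list" where
  "toggle D i y = (if y \<in> D \<and> flip i y \<in> D then flip i y else y)"

definition Rel :: "(idx \<Rightarrow> int \<Rightarrow> bool) \<Rightarrow> idx list set \<Rightarrow> word \<Rightarrow> word \<Rightarrow> bool" where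
  "Rel F D w v \<longleftrightarrow> disp w = disp v \<and>
     (\<forall>x y. fold (toggle D) (fired F w x) y = fold (toggle D) (fired F v x) y)"

lemma flip_cases:
  obtains z where "y = i # z" "flip i y = z" | "flip i y = i # y"
proof (cases "odd (length (takeWhile ((=) i) y))")
  case True
  then obtain z where z: "y = i # z" by (cases y) (auto split: if_splits)
  then show ?thesis using True that(1)[of z] by (simp add: flip_def)
next
  case False
  then show ?thesis using that(2) by (simp add: flip_def)
qed

lemma flip_flip [simp]: "flip i (flip i y) = y"
  by (cases y) (auto simp: flip_def)

lemma toggle_toggle [simp]: "toggle D i (toggle D i y) = y"
  by (auto simp: toggle_def)

lemma toggle_UNIV: "toggle UNIV = flip"
  by (auto simp: toggle_def fun_eq_iff)

lemma fold_involution: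
  assumes "\<And>i y. f i (f i y) = y"
  shows "fold f (rev u) (fold f u y) = y"
  by (induction u arbitrary: y) (auto simp: assms)

lemma marked_Rel: "marked (Rel F D)"
proof (rule markedI)
  fix w w' v v' assume "Rel F D w w'" "Rel F D v v'"
  then show "Rel F D (w @ v) (w' @ v')"
    by (simp add: Rel_def fired_append)
next
  fix w show "Rel F D (w @ winv w) []"
    by (simp add: Rel_def fired_append fired_winv fold_involution)
next
  show "Rel F D [(None, None, None)] []"
    by (simp add: Rel_def disp_Cons firing_def)
qed (auto simp: Rel_def)

text \<open>A word acting trivially on the base point reduces to the empty word.\<close>

lemma fold_flip_trivial:
  assumes inv: "\<And>i y. f i (f i y) = y" and "fold flip u [] = []"
  shows "fold f u y = y"
proof -
  \<comment> \<open>A list is read as the product of its entries with the head acting last; flipping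
    it then is left multiplication by \<open>i\<close>, for any involutions
    \<open>f\<close>.\<close>
  have step: "fold f (rev (flip i z)) y = f i (fold f (rev z) y)" for i z
    by (rule flip_cases[of z i]) (auto simp: inv)
  have "fold f u (fold f (rev z) y) = fold f (rev (fold flip u z)) y" for z
    by (induction u arbitrary: z) (auto simp: step[symmetric])
  from this[of "[]"] assms(2) show ?thesis by simp
qed

lemma length_flip: "length (flip i y) \<le> Suc (length y)"
  by (auto simp: flip_def)

text \<open>A flip lengthens a list by at most one, so under this hypothesis the truncation at
  length \<open>r\<close> is never felt.\<close>

lemma fold_toggle_bounded:
  "length u + length y \<le> r \<Longrightarrow> fold (toggle {y. length y \<le> r}) u y = fold flip u y"
proof (induction u arbitrary: y)
  case (Cons i u)
  have "toggle {y. length y \<le> r} i y = flip i y"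
    using Cons.prems length_flip[of i y] by (auto simp: toggle_def)
  then show ?case using Cons.prems length_flip[of i y] Cons.IH[of "flip i y"] by simp
qed simp

section \<open>Offset lamps and their periodic truncation\<close>

text \<open>The three involutions act at offsets \<open>-k, 0, k\<close>, so that words shorter than \<open>k / 2\<close> cannot
  see that they fail to commute.\<close>

definition offset_lamps :: "int \<Rightarrow> word \<Rightarrow> word \<Rightarrow> bool" where
  "offset_lamps k = Rel (\<lambda>i x. x = k * mv i) UNIV"

definition periodic_lamps :: "int \<Rightarrow> int \<Rightarrow> nat \<Rightarrow> word \<Rightarrow> word \<Rightarrow> bool" where
  "periodic_lamps k M r = Rel (\<lambda>i x. M dvd x - k * mv i) {y. length y \<le> r}"

lemma fold_replicate_even:
  assumes "\<And>y. f i (f i y) = y" "even n"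
  shows "fold f (replicate n i) y = y"
proof -
  obtain m where "n = 2 * m" using assms(2) by blast
  moreover have "fold f (replicate (2 * m) i) y = y"
    by (induction m) (auto simp: assms)
  ultimately show ?thesis by simp
qed

lemma abs_eq_mult_less:
  fixes k a d :: int assumes "k * a = d" "\<bar>d\<bar> < k" shows "a = 0 \<and> d = 0"
proof -
  have "a = 0"
  proof (rule ccontr)
    assume "a \<noteq> 0"
    then have "k * 1 \<le> k * \<bar>a\<bar>" using assms(2) by (intro mult_left_mono) auto
    also have "\<dots> = \<bar>k * a\<bar>" using assms(2) by (simp add: abs_mult)
    also have "\<dots> = \<bar>d\<bar>" using assms(1) by simp
    finally show False using assms(2) by simp
  qed
  then show ?thesis using assms(1) by simp
qed

text \<open>If some lamp fires in a fibre, then no other lamp and no other position of the cursor can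
  affect this fibre, and the parities in the lamplighter group decide.\<close>

lemma lamplighter_imp_offset_lamps:
  assumes "lamplighter w []" "2 * int (length w) < k"
  shows "offset_lamps k w []"
  unfolding offset_lamps_def Rel_def
proof (intro conjI allI)
  show "disp w = disp []" using assms(1) by (simp add: lamplighter_def)
  fix x :: int and y
  let ?F = "\<lambda>i x. x = k * mv i"
  show "fold (toggle UNIV) (fired ?F w x) y = fold (toggle UNIV) (fired ?F [] x) y"
  proof (cases "\<exists>i s. \<bar>s\<bar> \<le> int (length w) \<and> ?F i (x + s)")
    case True
    then obtain i s where s: "\<bar>s\<bar> \<le> int (length w)" "x + s = k * mv i" by blast
    let ?G = "\<lambda>i' z. i' = i \<and> z = (0 :: int)"
    have "fired ?F w x = fired ?G w (- s)"
    proof (rule fired_cong)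
      fix i' t assume t: "\<bar>t\<bar> \<le> int (length w)"
      show "(x + t = k * mv i') = ?G i' (- s + t)"
      proof
        assume "x + t = k * mv i'"
        then have "k * (mv i' - mv i) = t - s" using s by (simp add: algebra_simps)
        moreover have "\<bar>t - s\<bar> < k" using s t assms(2) by linarith
        ultimately have "mv i' - mv i = 0 \<and> t - s = 0" by (rule abs_eq_mult_less)
        then show "?G i' (- s + t)" by (simp add: mv_inj)
      qed (use s in auto)
    qed
    moreover have "set (fired ?G w (- s)) \<subseteq> {i}" using set_fired[of ?G w "- s"] by auto
    then have "fired ?G w (- s) = replicate (lampcount i w (- s)) i"
      unfolding lampcount_def by (intro replicate_length_same[symmetric]) blast
    moreover have "even (lampcount i w (- s))" using assms(1) by (simp add: lamplighter_def)
    then have "fold (toggle UNIV) (replicate (lampcount i w (- s)) i) y = y"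
      by (intro fold_replicate_even) simp_all
    ultimately show ?thesis by simp
  next
    case False
    then have "fired ?F w x = fired (\<lambda>_ _. False) w x" by (intro fired_cong) auto
    then show ?thesis by (simp add: fired_False)
  qed
qed

lemma abs_k_mv_diff: fixes k :: int assumes "k \<ge> 0" shows "\<bar>k * mv i - k * mv j\<bar> \<le> 2 * k"
proof -
  have "\<bar>mv i - mv j\<bar> \<le> 2" using abs_mv_le[of i] abs_mv_le[of j] by linarith
  then have "k * \<bar>mv i - mv j\<bar> \<le> k * 2" using assms by (intro mult_left_mono)
  moreover have "\<bar>k * mv i - k * mv j\<bar> = k * \<bar>mv i - mv j\<bar>"
    using assms by (simp add: right_diff_distrib[symmetric] abs_mult)
  ultimately show ?thesis by simp
qed

lemma dvd_diff_iff: fixes a b M :: int shows "M dvd b \<Longrightarrow> M dvd a \<longleftrightarrow> M dvd a - b"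
  by (metis diff_add_cancel dvd_add dvd_diff)

text \<open>Two firing positions within reach of the fibre differ by at most
  \<open>2 * k + 2 * length w\<close>, which is less than the period \<open>M\<close>, so congruence
  modulo \<open>M\<close> is equality there. The shift by \<open>s\<close> moves the one position
  known to be reached to its representative \<open>k * mv i\<close>.\<close>

lemma fired_periodic_window:
  assumes "k \<ge> 0" "2 * k + 2 * int (length w) < M"
    and s: "\<bar>s\<bar> \<le> int (length w)" "M dvd x + s - k * mv i"
  shows "fired (\<lambda>i x. M dvd x - k * mv i) w x = fired (\<lambda>i x. x = k * mv i) w (k * mv i - s)"
proof (rule fired_cong)
  fix j t assume t: "\<bar>t\<bar> \<le> int (length w)"
  have "M dvd x + t - k * mv j \<longleftrightarrow> M dvd (x + t - k * mv j) - (x + s - k * mv i)"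
    by (rule dvd_diff_iff[OF s(2)])
  also have "\<dots> \<longleftrightarrow> M dvd (t - s) + (k * mv i - k * mv j)"
    by (simp add: algebra_simps)
  also have "\<dots> \<longleftrightarrow> (t - s) + (k * mv i - k * mv j) = 0"
  proof
    assume "M dvd (t - s) + (k * mv i - k * mv j)"
    moreover have "\<bar>(t - s) + (k * mv i - k * mv j)\<bar> < M"
      using abs_k_mv_diff[OF assms(1), of i j] s(1) t assms(2) by linarith
    ultimately show "(t - s) + (k * mv i - k * mv j) = 0"
      by (metis abs_dvd_iff dvd_abs_iff zdvd_not_zless abs_ge_zero order_le_less abs_eq_0)
  qed simp
  finally show "M dvd x + t - k * mv j \<longleftrightarrow> k * mv i - s + t = k * mv j" by auto
qed

text \<open>A list of toggles that is trivial in the free product is trivial for all involutions, in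
  particular for the truncated ones. Conversely the orbit of the empty list decides triviality in
  the free product, and with two toggles per letter it stays within length
  \<open>2 * length w\<close>.\<close>

lemma periodic_lamps_iff_offset_lamps:
  assumes "k \<ge> 0" "2 * k + 2 * int (length w) < M" "2 * length w \<le> r"
  shows "periodic_lamps k M r w [] \<longleftrightarrow> offset_lamps k w []"
proof
  let ?F = "\<lambda>i x. x = k * mv i" and ?G = "\<lambda>i x. M dvd x - k * mv i"
  let ?D = "{y :: idx list. length y \<le> r}"
  {
    assume R: "offset_lamps k w []"
    show "periodic_lamps k M r w []"
      unfolding periodic_lamps_def Rel_def
    proof (intro conjI allI)
      show "disp w = disp []" using R by (simp add: offset_lamps_def Rel_def)
      fix x :: int and y
      show "fold (toggle ?D) (fired ?G w x) y = fold (toggle ?D) (fired ?G [] x) y"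
      proof (cases "\<exists>i s. \<bar>s\<bar> \<le> int (length w) \<and> ?G i (x + s)")
        case True
        then obtain i s where s: "\<bar>s\<bar> \<le> int (length w)" "M dvd x + s - k * mv i" by blast
        have "fold (toggle UNIV) (fired ?F w (k * mv i - s)) [] = []"
          using R by (simp add: offset_lamps_def Rel_def)
        then show ?thesis
          using fold_flip_trivial[of "toggle ?D" "fired ?F w (k * mv i - s)" y]
          by (simp add: fired_periodic_window[OF assms(1,2) s] toggle_UNIV)
      next
        case False
        then have "fired ?G w x = fired (\<lambda>_ _. False) w x" by (intro fired_cong) auto
        then show ?thesis by (simp add: fired_False)
      qed
    qed
  next
    assume R: "periodic_lamps k M r w []"
    show "offset_lamps k w []"
      unfolding offset_lamps_def Rel_def
    proof (intro conjI allI)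
      show "disp w = disp []" using R by (simp add: periodic_lamps_def Rel_def)
      fix x :: int and y
      show "fold (toggle UNIV) (fired ?F w x) y = fold (toggle UNIV) (fired ?F [] x) y"
      proof (cases "\<exists>i s. \<bar>s\<bar> \<le> int (length w) \<and> ?F i (x + s)")
        case True
        then obtain i s where s: "\<bar>s\<bar> \<le> int (length w)" "x + s = k * mv i" by blast
        have x: "x = k * mv i - s" using s(2) by simp
        have "fired ?G w x = fired ?F w x"
          using fired_periodic_window[OF assms(1,2) s(1), of x i] s(2) by (simp add: x)
        moreover have "fold (toggle ?D) (fired ?G w x) [] = []"
          using R by (simp add: periodic_lamps_def Rel_def)
        moreover have "length (fired ?F w x) \<le> r"
          using length_fired[of ?F w x] assms(3) by simp
        ultimately have "fold flip (fired ?F w x) [] = []"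
          using fold_toggle_bounded[of "fired ?F w x" "[]" r] by simp
        then show ?thesis
          using fold_flip_trivial[of "toggle UNIV" "fired ?F w x" y] by simp
      next
        case False
        then have "fired ?F w x = fired (\<lambda>_ _. False) w x" by (intro fired_cong) auto
        then show ?thesis by (simp add: fired_False)
      qed
    qed
  }
qed

section \<open>Finite extensions\<close>

text \<open>The kernel of the quotient map to the lamplighter group is finite.\<close>

definition fin_ext :: "(word \<Rightarrow> word \<Rightarrow> bool) \<Rightarrow> bool" where
  "fin_ext R \<longleftrightarrow> marked R \<and> (\<forall>w v. R w v \<longrightarrow> lamplighter w v) \<and>
     (\<exists>h :: word \<Rightarrow> nat. finite (range h) \<and> (\<forall>w v. lamplighter w v \<longrightarrow> h w = h v \<longrightarrow> R w v))"

lemma fin_ext_lamplighter: "fin_ext lamplighter"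
  unfolding fin_ext_def using marked_lamplighter by (auto intro!: exI[of _ "\<lambda>_. 0"])

lemma fold_toggle_outside: "y \<notin> D \<Longrightarrow> fold (toggle D) u y = y"
  by (induction u) (auto simp: toggle_def)

lemma fold_toggle_inside: "y \<in> D \<Longrightarrow> fold (toggle D) u y \<in> D"
  by (induction u arbitrary: y) (auto simp: toggle_def)

text \<open>A fibre depends on its position modulo \<open>M\<close> only, and lists longer than
  \<open>r\<close> are frozen. Up to its displacement, a word thus acts through a map on a finite
  set, and \<open>h\<close> numbers these maps.\<close>

lemma periodic_lamps_finite_index:
  assumes "M > 0"
  shows "\<exists>h :: word \<Rightarrow> nat. finite (range h) \<and>
    (\<forall>w v. disp w = disp v \<longrightarrow> h w = h v \<longrightarrow> periodic_lamps k M r w v)"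
proof -
  let ?G = "\<lambda>i x. M dvd x - k * mv i" and ?D = "{y :: idx list. length y \<le> r}"
  let ?X = "{0..<M} \<times> ?D"
  define g where "g w = restrict (\<lambda>(x, y). fold (toggle ?D) (fired ?G w x) y) ?X" for w
  have "finite ?D" using finite_lists_length_le[of "UNIV :: idx set" r] by simp
  then have fin: "finite (\<Pi>\<^sub>E p\<in>?X. ?D)" by (intro finite_PiE) auto
  have "range g \<subseteq> (\<Pi>\<^sub>E p\<in>?X. ?D)"
  proof -
    have "g w \<in> (\<Pi>\<^sub>E p\<in>?X. ?D)" for w
      unfolding g_def restrict_PiE_iff using fold_toggle_inside[of _ ?D] by auto
    then show ?thesis by auto
  qed
  then have fr: "finite (range g)" using fin finite_subset by blast
  then obtain e :: "_ \<Rightarrow> nat" where e: "inj_on e (range g)"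
    using finite_imp_inj_to_nat_seg by blast
  have "periodic_lamps k M r w v" if d: "disp w = disp v" and h: "e (g w) = e (g v)" for w v
    unfolding periodic_lamps_def Rel_def
  proof (intro conjI allI)
    show "disp w = disp v" by (fact d)
    fix x :: int and y
    have gg: "g w = g v" using e h by (auto dest: inj_onD)
    have per: "fired ?G u x = fired ?G u (x mod M)" for u
    proof (rule fired_cong)
      fix i :: idx and s :: int
      have "x + s - k * mv i = (x mod M + s - k * mv i) + M * (x div M)"
        by (simp add: algebra_simps)
      then show "M dvd x + s - k * mv i \<longleftrightarrow> M dvd x mod M + s - k * mv i"
        by (metis dvd_add_left_iff dvd_triv_left)
    qed
    show "fold (toggle ?D) (fired ?G w x) y = fold (toggle ?D) (fired ?G v x) y"
    proof (cases "y \<in> ?D")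
      case True
      then have "(x mod M, y) \<in> ?X" using assms by auto
      then have "g u (x mod M, y) = fold (toggle ?D) (fired ?G u x) y" for u
        by (simp add: g_def per[of u])
      then show ?thesis using gg by metis
    qed (simp add: fold_toggle_outside)
  qed
  moreover have "finite (range (e \<circ> g))" using fr by (metis finite_imageI image_comp)
  ultimately show ?thesis by (intro exI[of _ "e \<circ> g"]) auto
qed

text \<open>The relation \<open>lamplighter\<close> already fixes the displacement, so the numbering
  of the periodic actions can be paired with the one of the given kernel.\<close>

lemma fin_ext_conj_periodic_lamps:
  assumes "fin_ext R" "M > 0"
  shows "fin_ext (\<lambda>w v. R w v \<and> periodic_lamps k M r w v)"
proof -
  obtain h :: "word \<Rightarrow> nat" where h: "finite (range h)"
    "\<And>w v. lamplighter w v \<Longrightarrow> h w = h v \<Longrightarrow> R w v"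
    using assms(1) unfolding fin_ext_def by blast
  obtain h' :: "word \<Rightarrow> nat" where h': "finite (range h')"
    "\<And>w v. disp w = disp v \<Longrightarrow> h' w = h' v \<Longrightarrow> periodic_lamps k M r w v"
    using periodic_lamps_finite_index[OF assms(2)] by blast
  have "finite (range (\<lambda>w. prod_encode (h w, h' w)))"
    by (rule finite_subset[of _ "prod_encode ` (range h \<times> range h')"]) (use h h' in auto)
  moreover have "periodic_lamps k M r w v" "R w v"
    if "lamplighter w v" "prod_encode (h w, h' w) = prod_encode (h v, h' v)" for w v
    using that h(2) h'(2) by (auto simp: lamplighter_def)
  ultimately show ?thesis
    using assms(1) marked_conj[of R "periodic_lamps k M r"] marked_Rel unfolding fin_ext_def periodic_lamps_def
    by (intro conjI exI[of _ "\<lambda>w. prod_encode (h w, h' w)"]) auto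
qed

section \<open>The displacement process\<close>

definition maxdisp :: "word \<Rightarrow> nat" where
  "maxdisp w = Max ((\<lambda>t. nat \<bar>disp (take t w)\<bar>) ` {..length w})"

lemma maxdisp_Nil [simp]: "maxdisp [] = 0"
  by (simp add: maxdisp_def)

lemma maxdisp_snoc: "maxdisp (w @ [l]) = max (maxdisp w) (nat \<bar>disp (w @ [l])\<bar>)"
proof -
  have "(\<lambda>t. nat \<bar>disp (take t (w @ [l]))\<bar>) ` {..length (w @ [l])} =
    insert (nat \<bar>disp (w @ [l])\<bar>) ((\<lambda>t. nat \<bar>disp (take t w)\<bar>) ` {..length w})"
    by (auto simp: atMost_Suc)
  then show ?thesis unfolding maxdisp_def by (subst max.commute) (simp del: disp_append)
qed

lemma disp_le_maxdisp: "\<bar>disp w\<bar> \<le> int (maxdisp w)"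
proof -
  have "nat \<bar>disp (take (length w) w)\<bar> \<le> maxdisp w"
    unfolding maxdisp_def by (intro Max_ge finite_imageI finite_atMost imageI) simp
  then show ?thesis by simp
qed

lemma maxdisp_le_length: "maxdisp w \<le> length w"
proof (induction w rule: rev_induct)
  case (snoc l w)
  have "nat \<bar>disp (w @ [l])\<bar> \<le> length (w @ [l])" using abs_disp_le[of "w @ [l]"] by linarith
  then show ?case using snoc by (simp add: maxdisp_snoc del: disp_append)
qed simp

lemma disp_snoc: "disp (w @ [l]) = disp w + mv (fst (snd l))"
  by (simp add: disp_Cons)

lemma avg_Suc_mv:
  assumes "\<And>w l. f (w @ [l]) = g w (mv (fst (snd l)))"
  shows "avg (Suc n) f = avg n (\<lambda>w. (g w 0 + g w 1 + g w (- 1)) / 3)"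
  by (simp add: avg_Suc assms sum_letter_mv)

text \<open>The function \<open>cos (\<theta> x)\<close> is an eigenfunction of the walk killed on leaving \<open>[-r, r]\<close>,
  since it vanishes at \<open>r + 1\<close> and \<open>-r - 1\<close>.\<close>

lemma avg_confined_cos:
  fixes r :: nat
  defines "t \<equiv> pi / (2 * (real r + 1))"
  shows "avg n (\<lambda>w. of_bool (maxdisp w \<le> r) * cos (t * disp w)) = ((1 + 2 * cos t) / 3) ^ n"
proof (induction n)
  case (Suc n)
  have edge: "cos (t * of_int d) = 0" if "\<bar>d\<bar> = int r + 1" for d
  proof -
    have "t * of_int \<bar>d\<bar> = pi / 2" unfolding that t_def by (simp add: field_simps)
    then have "\<bar>t * of_int d\<bar> = pi / 2"
      by (simp add: abs_mult t_def)
    then show ?thesis by (metis cos_abs_real cos_pi_half)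
  qed
  let ?g = "\<lambda>w z. of_bool (max (maxdisp w) (nat \<bar>disp w + z\<bar>) \<le> r) * cos (t * real_of_int (disp w + z))"
  have "avg (Suc n) (\<lambda>w. of_bool (maxdisp w \<le> r) * cos (t * disp w)) =
      avg n (\<lambda>w. (?g w 0 + ?g w 1 + ?g w (- 1)) / 3)"
    by (rule avg_Suc_mv) (simp add: maxdisp_snoc disp_snoc del: disp_append)
  also have "\<dots> = avg n (\<lambda>w. (1 + 2 * cos t) / 3 * (of_bool (maxdisp w \<le> r) * cos (t * disp w)))"
  proof (rule avg_cong)
    fix w :: word
    show "(?g w 0 + ?g w 1 + ?g w (- 1)) / 3 =
      (1 + 2 * cos t) / 3 * (of_bool (maxdisp w \<le> r) * cos (t * disp w))"
    proof (cases "maxdisp w \<le> r")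
      case True
      then have d: "\<bar>disp w\<bar> \<le> int r" using disp_le_maxdisp[of w] by linarith
      have g: "?g w z = cos (t * real_of_int (disp w + z))" if "\<bar>z\<bar> \<le> 1" for z
      proof (cases "\<bar>disp w + z\<bar> \<le> int r")
        case False
        then have "\<bar>disp w + z\<bar> = int r + 1" using d that by linarith
        then show ?thesis using edge by (simp only: mult_zero_right)
      qed (use True in auto)
      have g0: "?g w 0 = cos (t * real_of_int (disp w + 0))" by (rule g) simp
      have g1: "?g w 1 = cos (t * real_of_int (disp w + 1))" by (rule g) simp
      have g2: "?g w (- 1) = cos (t * real_of_int (disp w + (- 1)))" by (rule g) simp
      show ?thesis
        unfolding g0 g1 g2 using True by (simp add: algebra_simps cos_add cos_diff)
    qed simp
  qed
  also have "\<dots> = ((1 + 2 * cos t) / 3) ^ Suc n"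
    by (simp only: avg_cmult Suc) simp
  finally show ?case .
qed simp

lemma sin_ge_half: assumes "0 \<le> x" "x \<le> 1" shows "x / 2 \<le> sin (x :: real)"
proof -
  have "sin 0 - 0 / 2 \<le> sin x - x / 2"
  proof (rule DERIV_nonneg_imp_nondecreasing[OF assms(1)])
    fix y assume y: "0 \<le> y" "y \<le> x"
    have "cos (pi / 3) \<le> cos y"
      using y assms pi_gt3 by (intro cos_monotone_0_pi_le) auto
    then show "\<exists>z. ((\<lambda>y. sin y - y / 2) has_real_derivative z) (at y) \<and> 0 \<le> z"
      by (intro exI[of _ "cos y - 1 / 2"]) (auto intro!: derivative_eq_intros simp: cos_60)
  qed
  then show ?thesis by simp
qed

text \<open>The eigenfunction is at most 1, so the probability of confinement dominates the power of
  the eigenvalue, which is at least \<open>1 - t\<^sup>2 / 3\<close>. The constant 1 comes from pi^2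
  / 12 < 1.\<close>

lemma avg_confined_ge:
  assumes "r > 0"
  shows "(1 - 1 / (real r + 1)\<^sup>2) ^ n \<le> avg n (\<lambda>w. of_bool (maxdisp w \<le> r))"
proof -
  define t where "t = pi / (2 * (real r + 1))"
  have "(sin (t / 2))\<^sup>2 \<le> (t / 2)\<^sup>2"
    using abs_sin_x_le_abs_x[of "t / 2"] by (simp add: abs_le_square_iff[symmetric])
  moreover have "cos t = 1 - 2 * (sin (t / 2))\<^sup>2" using cos_double_sin[of "t / 2"] by simp
  ultimately have "1 - t\<^sup>2 / 3 \<le> (1 + 2 * cos t) / 3" by (simp add: power2_eq_square)
  moreover have "t\<^sup>2 / 3 \<le> 1 / (real r + 1)\<^sup>2"
  proof -
    have "pi\<^sup>2 \<le> 3.2\<^sup>2" using pi_approx by (intro power_mono) auto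
    then have "pi\<^sup>2 / 12 * (1 / (real r + 1)\<^sup>2) \<le> 1 * (1 / (real r + 1)\<^sup>2)"
      by (intro mult_right_mono) (auto simp: power2_eq_square)
    then show ?thesis
      by (simp add: t_def power_divide power_mult_distrib del: distrib_left_numeral)
  qed
  ultimately have "1 - 1 / (real r + 1)\<^sup>2 \<le> (1 + 2 * cos t) / 3" by linarith
  moreover have "0 \<le> 1 - 1 / (real r + 1)\<^sup>2" by (simp add: divide_le_eq one_le_power)
  ultimately have "(1 - 1 / (real r + 1)\<^sup>2) ^ n \<le> ((1 + 2 * cos t) / 3) ^ n"
    by (rule power_mono)
  also have "\<dots> \<le> avg n (\<lambda>w. of_bool (maxdisp w \<le> r))"
    unfolding t_def avg_confined_cos[symmetric] by (intro avg_mono) auto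
  finally show ?thesis .
qed

text \<open>The eigenfunction of the interval of twice the size is nonnegative up to
  \<open>R\<close> and at least 1/2 on [-r, r]; this explains \<open>R + 1 = 2 * (r + 1)\<close> and
  the factor 2.\<close>

lemma avg_confined_le:
  "avg n (\<lambda>w. of_bool (maxdisp w \<le> r)) \<le> 2 * (1 - 1 / (32 * (real r + 1)\<^sup>2)) ^ n"
proof -
  define R where "R = 2 * r + 1"
  define t where "t = pi / (2 * (real R + 1))"
  have t: "0 \<le> t" "t * (real r + 1) = pi / 4" by (auto simp: t_def R_def field_simps)
  have cos_ge: "1 / 2 \<le> cos (t * of_int d)" if "\<bar>d\<bar> \<le> int r" for d
  proof -
    have "\<bar>t * of_int d\<bar> = t * of_int \<bar>d\<bar>" using t by (simp add: abs_mult)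
    also have "\<dots> \<le> t * (real r + 1)" using that t by (intro mult_left_mono) auto
    also have "\<dots> \<le> pi / 3" using t(2) pi_gt_zero by linarith
    finally have "cos (pi / 3) \<le> cos \<bar>t * of_int d\<bar>"
      by (intro cos_monotone_0_pi_le) auto
    then show ?thesis by (simp add: cos_60)
  qed
  have "avg n (\<lambda>w. of_bool (maxdisp w \<le> r)) \<le>
      avg n (\<lambda>w. 2 * (of_bool (maxdisp w \<le> R) * cos (t * disp w)))"
  proof (rule avg_mono)
    fix w :: word
    consider "maxdisp w \<le> r" | "r < maxdisp w" "maxdisp w \<le> R" | "R < maxdisp w" by linarith
    then show "of_bool (maxdisp w \<le> r) \<le> 2 * (of_bool (maxdisp w \<le> R) * cos (t * disp w))"
    proof cases
      case 1
      then have "1 / 2 \<le> cos (t * disp w)" using disp_le_maxdisp[of w] by (intro cos_ge) linarith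
      moreover have "maxdisp w \<le> R" using 1 by (simp add: R_def)
      ultimately show ?thesis using 1 by simp
    next
      case 2
      have "\<bar>t * disp w\<bar> = t * of_int \<bar>disp w\<bar>" using t by (simp add: abs_mult)
      also have "\<dots> \<le> t * (real R + 1)"
        using 2 t disp_le_maxdisp[of w] by (intro mult_left_mono) auto
      also have "\<dots> = pi / 2" by (simp add: t_def del: distrib_left_numeral)
      finally have "0 \<le> cos (t * disp w)" by (intro cos_ge_zero) (auto simp: abs_le_iff)
      then show ?thesis using 2 by simp
    qed (simp add: R_def)
  qed
  also have "\<dots> = 2 * ((1 + 2 * cos t) / 3) ^ n"
    unfolding avg_cmult t_def avg_confined_cos ..
  also have "\<dots> \<le> 2 * (1 - 1 / (32 * (real r + 1)\<^sup>2)) ^ n"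
  proof -
    have tr: "t = pi / (4 * (real r + 1))" by (simp add: t_def R_def)
    have t4: "t \<le> pi / 4" unfolding tr by (intro divide_left_mono) auto
    then have t1: "t / 2 \<le> 1" using pi_less_4 by linarith
    have "(t / 4)\<^sup>2 \<le> (sin (t / 2))\<^sup>2"
      using sin_ge_half[OF _ t1] t by (intro power_mono) auto
    moreover have "cos t = 1 - 2 * (sin (t / 2))\<^sup>2" using cos_double_sin[of "t / 2"] by simp
    ultimately have "(1 + 2 * cos t) / 3 \<le> 1 - t\<^sup>2 / 12" by (simp add: power2_eq_square)
    moreover have "1 / (32 * (real r + 1)\<^sup>2) \<le> t\<^sup>2 / 12"
    proof -
      have "3\<^sup>2 \<le> pi\<^sup>2" using pi_gt3 by (intro power_mono) auto
      then have "1 / 32 * (1 / (real r + 1)\<^sup>2) \<le> pi\<^sup>2 / 192 * (1 / (real r + 1)\<^sup>2)"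
        by (intro mult_right_mono) auto
      then show ?thesis
        by (simp add: tr power_divide power_mult_distrib del: distrib_left_numeral)
    qed
    ultimately have "(1 + 2 * cos t) / 3 \<le> 1 - 1 / (32 * (real r + 1)\<^sup>2)" by linarith
    moreover have "0 \<le> cos t" using t4 t(1) pi_gt_zero by (intro cos_ge_zero) linarith+
    ultimately show ?thesis by (intro mult_left_mono power_mono) auto
  qed
  finally show ?thesis .
qed

lemma avg_disp_sq: "avg n (\<lambda>w. (real_of_int (disp w))\<^sup>2) = 2 * real n / 3"
proof (induction n)
  case (Suc n)
  have "avg (Suc n) (\<lambda>w. (real_of_int (disp w))\<^sup>2) =
      avg n (\<lambda>w. ((real_of_int (disp w + 0))\<^sup>2 + (real_of_int (disp w + 1))\<^sup>2
        + (real_of_int (disp w + (- 1)))\<^sup>2) / 3)"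
    by (rule avg_Suc_mv[where g = "\<lambda>w z. (real_of_int (disp w + z))\<^sup>2"])
      (simp add: disp_snoc del: disp_append)
  also have "\<dots> = avg n (\<lambda>w. (real_of_int (disp w))\<^sup>2 + 2 / 3)"
    by (intro avg_cong) (simp add: power2_eq_square algebra_simps)
  also have "\<dots> = 2 * real (Suc n) / 3"
    by (simp only: avg_add avg_const Suc) (simp add: field_simps)
  finally show ?case .
qed simp

lemma avg_disp_4: "avg n (\<lambda>w. (real_of_int (disp w)) ^ 4) \<le> 2 * (real n)\<^sup>2"
proof -
  have "avg n (\<lambda>w. (real_of_int (disp w)) ^ 4) = 4 * (real n)\<^sup>2 / 3 - 2 * real n / 3"
  proof (induction n)
    case (Suc n)
    have "avg (Suc n) (\<lambda>w. (real_of_int (disp w)) ^ 4) =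
        avg n (\<lambda>w. ((real_of_int (disp w + 0)) ^ 4 + (real_of_int (disp w + 1)) ^ 4
          + (real_of_int (disp w + (- 1))) ^ 4) / 3)"
      by (rule avg_Suc_mv[where g = "\<lambda>w z. (real_of_int (disp w + z)) ^ 4"])
        (simp add: disp_snoc del: disp_append)
    also have "\<dots> = avg n (\<lambda>w. ((real_of_int (disp w)) ^ 4 + 4 * (real_of_int (disp w))\<^sup>2) + 2 / 3)"
      by (intro avg_cong) (simp add: power2_eq_square power4_eq_xxxx algebra_simps)
    also have "\<dots> = 4 * (real (Suc n))\<^sup>2 / 3 - 2 * real (Suc n) / 3"
      by (simp only: avg_add avg_const avg_cmult avg_disp_sq Suc)
        (simp add: power2_eq_square field_simps)
    finally show ?case .
  qed simp
  also have "\<dots> \<le> 2 * (real n)\<^sup>2" using zero_le_power2[of "real n"] by linarith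
  finally show ?thesis .
qed

text \<open>Fourth moment method: \<open>1 / a * x\<^sup>2 - 1 / a ^ 3 * x ^ 4\<close> is a lower
  bound for the absolute value, and its mean is estimated by the second and fourth moments. The
  choice \<open>a = 3 * sqrt n\<close> maximizes the resulting bound.\<close>

lemma avg_abs_disp: "4 / 27 * sqrt n \<le> avg n (\<lambda>w. \<bar>real_of_int (disp w)\<bar>)"
proof (cases "n = 0")
  case False
  define a where "a = 3 * sqrt n"
  have a: "a > 0" "a\<^sup>2 = 9 * n" using False by (auto simp: a_def power_mult_distrib)
  have ineq: "1 / a * x\<^sup>2 - 1 / a ^ 3 * x ^ 4 \<le> \<bar>x\<bar>" for x :: real
  proof -
    have "u\<^sup>2 - u ^ 4 \<le> u" if "u \<ge> 0" for u :: real
    proof (cases "u \<le> 1")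
      case True
      then have "u * u \<le> u * 1" using that by (intro mult_left_mono)
      moreover have "0 \<le> u ^ 4" by simp
      ultimately show ?thesis unfolding power2_eq_square by linarith
    next
      case False
      then have "u ^ 2 \<le> u ^ 4" by (intro power_increasing) auto
      then show ?thesis using that by simp
    qed
    from this[of "\<bar>x\<bar> / a"] have "a * ((\<bar>x\<bar> / a)\<^sup>2 - (\<bar>x\<bar> / a) ^ 4) \<le> a * (\<bar>x\<bar> / a)"
      using a by (intro mult_left_mono) auto
    moreover have "a * ((\<bar>x\<bar> / a)\<^sup>2 - (\<bar>x\<bar> / a) ^ 4) = 1 / a * x\<^sup>2 - 1 / a ^ 3 * x ^ 4"
      using a(1) by (simp add: field_simps power_divide power2_eq_square power3_eq_cube power4_eq_xxxx)
    ultimately show ?thesis using a by simp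
  qed
  have "4 / 27 * sqrt n = 1 / a * (2 * real n / 3) - 1 / a ^ 3 * (2 * (real n)\<^sup>2)"
  proof -
    have n: "real n = a\<^sup>2 / 9" using a by simp
    have s: "sqrt n = a / 3" by (simp add: a_def)
    have "4 / 27 * (a / 3) = 1 / a * (2 * (a\<^sup>2 / 9) / 3) - 1 / a ^ 3 * (2 * (a\<^sup>2 / 9)\<^sup>2)"
      using a(1) by (simp add: field_simps power2_eq_square power3_eq_cube)
    then show ?thesis by (simp only: s[symmetric] n[symmetric])
  qed
  also have "\<dots> \<le> 1 / a * avg n (\<lambda>w. (real_of_int (disp w))\<^sup>2)
      - 1 / a ^ 3 * avg n (\<lambda>w. (real_of_int (disp w)) ^ 4)"
    unfolding avg_disp_sq using a avg_disp_4[of n] by (intro diff_left_mono mult_left_mono) auto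
  also have "\<dots> = avg n (\<lambda>w. 1 / a * (real_of_int (disp w))\<^sup>2 - 1 / a ^ 3 * (real_of_int (disp w)) ^ 4)"
    unfolding avg_diff avg_cmult ..
  also have "\<dots> \<le> avg n (\<lambda>w. \<bar>real_of_int (disp w)\<bar>)"
    by (intro avg_mono ineq)
  finally show ?thesis .
qed simp

lemma sum_inverse_le: "(\<Sum>r<Suc n. 1 / (real r + 1)) \<le> 1 + ln (real (Suc n))"
proof (induction n)
  case (Suc n)
  have "ln ((real n + 1) / (real n + 2)) \<le> (real n + 1) / (real n + 2) - 1"
    by (rule ln_le_minus_one) auto
  also have "\<dots> = - (1 / (real n + 2))" by (simp add: field_simps)
  finally have "1 / (real n + 2) \<le> ln (real n + 2) - ln (real n + 1)"
    by (simp add: ln_div)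
  then show ?case using Suc by (simp add: add.commute)
qed simp

text \<open>The tail probabilities are at most \<open>2 * n / (r + 1)\<^sup>2\<close> by Bernoulli's
  inequality. Being at most 1, they are also bounded by the square root of this, and summing gives a
  harmonic sum. The logarithm is harmless for the exponents.\<close>

lemma avg_maxdisp_le:
  assumes "n > 0"
  shows "avg n (\<lambda>w. real (maxdisp w)) \<le> sqrt (2 * real n) * (1 + ln n)"
proof -
  have "avg n (\<lambda>w. real (maxdisp w)) = avg n (\<lambda>w. \<Sum>r<n. of_bool (r < maxdisp w))"
  proof (rule avg_cong)
    fix w :: word assume "length w = n"
    then have "{r \<in> {..<n}. r < maxdisp w} = {..<maxdisp w}" using maxdisp_le_length[of w] by auto
    then have "card {r \<in> {..<n}. r < maxdisp w} = maxdisp w" by simp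
    then show "real (maxdisp w) = (\<Sum>r<n. of_bool (r < maxdisp w))"
      by (simp add: of_bool_def sum.If_cases Int_def)
  qed
  also have "\<dots> = (\<Sum>r<n. avg n (\<lambda>w. of_bool (r < maxdisp w)))" by (rule avg_sum)
  also have "\<dots> \<le> (\<Sum>r<n. sqrt (2 * real n) * (1 / (real r + 1)))"
  proof (rule sum_mono)
    fix r
    define p where "p = avg n (\<lambda>w. of_bool (r < maxdisp w))"
    have p01: "0 \<le> p" "p \<le> 1"
      unfolding p_def using avg_mono[of n "\<lambda>w. of_bool (r < maxdisp w)" "\<lambda>_. 1"]
      by (auto intro!: avg_nonneg simp: avg_const)
    have "p \<le> 2 * n / (real r + 1)\<^sup>2"
    proof (cases "r = 0")
      case True
      then show ?thesis using p01 assms by simp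
    next
      case False
      have "p = avg n (\<lambda>w. 1 - of_bool (maxdisp w \<le> r))"
        unfolding p_def by (intro avg_cong) auto
      also have "\<dots> = 1 - avg n (\<lambda>w. of_bool (maxdisp w \<le> r))"
        by (simp only: avg_diff avg_const)
      also have "\<dots> \<le> 1 - (1 + (- (1 / (real r + 1)\<^sup>2))) ^ n"
        using avg_confined_ge[of r n] False by simp
      also have "\<dots> \<le> - (real n * (- (1 / (real r + 1)\<^sup>2)))"
        using Bernoulli_inequality[of "- (1 / (real r + 1)\<^sup>2)" n]
        by (simp add: divide_le_eq one_le_power)
      also have "\<dots> \<le> 2 * n / (real r + 1)\<^sup>2" by (simp add: divide_right_mono)
      finally show ?thesis .
    qed
    then have "p * p \<le> 2 * n / (real r + 1)\<^sup>2"
      using mult_right_mono[OF p01(2,1)] by linarith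
    then have "p\<^sup>2 \<le> (sqrt (2 * real n) * (1 / (real r + 1)))\<^sup>2"
      by (simp add: power2_eq_square[of p] power_mult_distrib power_divide)
    then show "p \<le> sqrt (2 * real n) * (1 / (real r + 1))"
      by (rule power2_le_imp_le) simp
  qed
  also have "\<dots> = sqrt (2 * real n) * (\<Sum>r<n. 1 / (real r + 1))"
    by (simp only: sum_distrib_left)
  also have "\<dots> \<le> sqrt (2 * real n) * (1 + ln n)"
    using sum_inverse_le[of "n - 1"] assms by (intro mult_left_mono) auto
  finally show ?thesis .
qed

section \<open>Return probability of the lamplighter group\<close>

text \<open>Erases the toggles and keeps the trajectory, so that a configuration
  \<open>G (strip w)\<close> may depend on the path but not on the lamps.\<close>

definition strip :: "word \<Rightarrow> word" where
  "strip w = map (\<lambda>(i, m, j). (None, m, None)) w"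

lemma strip_snoc: "strip (w @ [(i, m, j)]) = strip w @ [(None, m, None)]"
  by (simp add: strip_def)

lemma strip_Nil [simp]: "strip [] = []"
  by (simp add: strip_def)

lemma disp_strip [simp]: "disp (strip w) = disp w"
  by (induction w) (auto simp: strip_def disp_Cons)

lemma maxdisp_strip [simp]: "maxdisp (strip w) = maxdisp w"
  by (induction w rule: rev_induct) (auto simp: strip_snoc maxdisp_snoc disp_snoc simp del: disp_append)

lemma lampcount_snoc: "lampcount i (w @ [(a, m, b)]) x = lampcount i w x + of_bool (a = Some i \<and> x + disp w = 0)
    + of_bool (b = Some i \<and> x + disp w + mv m = 0)"
  by (auto simp: lampcount_append) (auto simp: lampcount_def firing_def split: option.splits)

lemma lampcount_eq_0: "\<bar>x\<bar> > int (maxdisp w) \<Longrightarrow> lampcount i w x = 0"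
proof (induction w rule: rev_induct)
  case (snoc l w)
  obtain a m b where l: "l = (a, m, b)" by (cases l)
  have "\<bar>x\<bar> > int (maxdisp w)" "\<bar>x\<bar> > \<bar>disp w + mv m\<bar>"
    using snoc.prems by (auto simp: maxdisp_snoc disp_snoc l simp del: disp_append)
  moreover from this have "x + disp w \<noteq> 0" "x + disp w + mv m \<noteq> 0"
    using disp_le_maxdisp[of w] by linarith+
  ultimately show ?case using snoc.IH by (simp add: l lampcount_snoc)
qed simp

text \<open>Each time the walk reaches a new maximal distance from the origin, the lamp at the new
  position is still off, so that only three of the four possible second toggles in that step are
  compatible with a configuration prescribed in terms of the trajectory.\<close>

lemma avg_lampcount_maxdisp_le:
  "avg n (\<lambda>w. of_bool (\<forall>x. odd (lampcount i w x) = G (strip w) x) * (4 / 3) ^ maxdisp w) \<le> 1"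
proof (induction n arbitrary: G)
  case 0
  show ?case by simp
next
  case (Suc n)
  define P where "P G w = of_bool (\<forall>x. odd (lampcount i w x) = G (strip w) x) * (4 / 3 :: real) ^ maxdisp w"
    for G :: "word \<Rightarrow> int \<Rightarrow> bool" and w
  \<comment> \<open>The configuration that \<open>w\<close> must show for its extension to show
    \<open>G\<close>: the toggles of the last letter are undone, and a lamp at a new maximal
    distance must be off. The induction is over all \<open>G\<close> because undoing a letter
    changes the configuration.\<close>
  define G' where "G' a m b v x =
      (let p = disp v + mv m; g = (G (v @ [(None, m, None)]) x \<noteq> (a = Some i \<and> x = - disp v)) in
       if nat \<bar>p\<bar> > maxdisp v then x \<noteq> - p \<and> g else g \<noteq> (b = Some i \<and> x = - p))"
    for a m b v x
  have key: "(\<Sum>b\<in>UNIV. P G (w @ [(a, m, b)])) \<le> (\<Sum>b\<in>UNIV. P (G' a m b) w)" for a m w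
  proof (cases "nat \<bar>disp w + mv m\<bar> > maxdisp w")
    case False
    have "P G (w @ [(a, m, b)]) = P (G' a m b) w" for b
    proof -
      have "maxdisp (w @ [(a, m, b)]) = maxdisp w"
        using False by (simp add: maxdisp_snoc disp_snoc del: disp_append)
      moreover have "odd (lampcount i (w @ [(a, m, b)]) x) = G (strip (w @ [(a, m, b)])) x \<longleftrightarrow>
          odd (lampcount i w x) = G' a m b (strip w) x" for x
      proof -
        have "x + disp w = 0 \<longleftrightarrow> x = - disp w" "x + disp w + mv m = 0 \<longleftrightarrow> x = - (disp w + mv m)"
          by linarith+
        then show ?thesis
          using False by (auto simp: lampcount_snoc strip_snoc G'_def Let_def)
      qed
      ultimately show ?thesis by (simp add: P_def)
    qed
    then show ?thesis by simp
  next
    case True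
    define p where "p = disp w + mv m"
    define g where "g = G (strip w @ [(None, m, None)]) (- p)"
    have p: "\<bar>p\<bar> = int (maxdisp w) + 1" "nat \<bar>p\<bar> = Suc (maxdisp w)"
      using True disp_le_maxdisp[of w] abs_mv_le[of m] unfolding p_def by linarith+
    have c0: "lampcount i w (- p) = 0" using p by (intro lampcount_eq_0) simp
    have pd: "- p \<noteq> - disp w" using p disp_le_maxdisp[of w] by linarith
    have "P G (w @ [(a, m, b)]) \<le> of_bool ((b = Some i) = g) * (4 / 3 * P (G' a m None) w)" for b
    proof -
      have "maxdisp (w @ [(a, m, b)]) = Suc (maxdisp w)"
        using p by (simp add: maxdisp_snoc disp_snoc p_def del: disp_append)
      moreover have "(b = Some i) = g \<and> odd (lampcount i w x) = G' a m None (strip w) x"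
        if *: "\<forall>x. odd (lampcount i (w @ [(a, m, b)]) x) = G (strip (w @ [(a, m, b)])) x" for x
      proof
        have "odd (of_bool (b = Some i) :: nat) = g"
          using spec[OF *, of "- p"] c0 pd by (simp add: lampcount_snoc strip_snoc g_def p_def)
        then show "(b = Some i) = g" by simp
        have e: "x + disp w = 0 \<longleftrightarrow> x = - disp w" "x + disp w + mv m = 0 \<longleftrightarrow> x = - p"
          unfolding p_def by linarith+
        show "odd (lampcount i w x) = G' a m None (strip w) x"
        proof (cases "x = - p")
          case True
          then show ?thesis using c0 p by (simp add: G'_def Let_def p_def)
        next
          case False
          then show ?thesis
            using spec[OF *, of x] p by (auto simp: lampcount_snoc strip_snoc G'_def Let_def e p_def[symmetric])
        qed
      qed
      ultimately show ?thesis by (auto simp: P_def)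
    qed
    then have "(\<Sum>b\<in>UNIV. P G (w @ [(a, m, b)])) \<le>
        (\<Sum>b\<in>UNIV. of_bool ((b = Some i) = g) * (4 / 3 * P (G' a m None) w))"
      by (rule sum_mono)
    also have "\<dots> = (\<Sum>b\<in>UNIV. of_bool ((b = Some i) = g)) * (4 / 3 * P (G' a m None) w)"
      by (simp only: sum_distrib_right)
    \<comment> \<open>Three values of \<open>b\<close> are admissible if the new lamp has to stay
      off and one otherwise. As 3 * 4/3 = 4 is the number of values of \<open>b\<close>, the growing
      weight is paid for exactly.\<close>
    also have "\<dots> \<le> 3 * (4 / 3 * P (G' a m None) w)"
    proof (rule mult_right_mono)
      have "(\<Sum>b\<in>UNIV. of_bool ((b = Some i) = g)) \<le> (3 :: real)"
      proof -
        have "i \<in> {None, Some True, Some False}" using UNIV_idx by blast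
        then show ?thesis by (cases g) (auto simp: UNIV_option_conv UNIV_bool)
      qed
      then show "(\<Sum>b\<in>UNIV. of_bool ((b = Some i) = g)) \<le> (3 :: real)" .
    qed (simp add: P_def)
    also have "\<dots> = (\<Sum>b\<in>(UNIV :: idx option set). P (G' a m None) w)"
      by (simp add: card_option)
    also have "\<dots> = (\<Sum>b\<in>UNIV. P (G' a m b) w)"
    proof (rule sum.cong)
      fix b
      have "G' a m None (strip w) = G' a m b (strip w)"
        using True by (auto simp: G'_def Let_def fun_eq_iff)
      then show "P (G' a m None) w = P (G' a m b) w" by (simp add: P_def)
    qed simp
    finally show ?thesis .
  qed
  have "avg (Suc n) (P G) = avg n (\<lambda>w. (\<Sum>a\<in>UNIV. \<Sum>m\<in>UNIV. \<Sum>b\<in>UNIV. P G (w @ [(a, m, b)])) / 48)"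
    by (simp only: avg_Suc sum_letter)
  also have "\<dots> \<le> avg n (\<lambda>w. (\<Sum>a\<in>UNIV. \<Sum>m\<in>UNIV. \<Sum>b\<in>UNIV. P (G' a m b) w) / 48)"
    by (intro avg_mono divide_right_mono sum_mono key) simp
  also have "\<dots> = 1 / 48 * (\<Sum>a\<in>UNIV. \<Sum>m\<in>UNIV. \<Sum>b\<in>UNIV. avg n (P (G' a m b)))"
    by (simp add: avg_cmult[of n "1 / 48", simplified] avg_sum)
  also have "\<dots> \<le> 1 / 48 * (\<Sum>a\<in>(UNIV :: idx option set). \<Sum>m\<in>(UNIV :: idx set). \<Sum>b\<in>(UNIV :: idx option set). 1)"
    using Suc.IH unfolding P_def by (intro mult_left_mono sum_mono) auto
  also have "\<dots> = 1" by (simp add: card_option)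
  finally show ?case by (simp add: P_def[abs_def])
qed

text \<open>Either the walk stays within [-r, r], or the weight \<open>(4 / 3) ^ maxdisp w\<close>
  is at least \<open>(4 / 3) ^ r\<close>. In the second case it is enough to ask that all lamps with
  index \<open>None\<close> are off.\<close>

lemma ret_lamplighter_le:
  "ret lamplighter n \<le> 2 * (1 - 1 / (32 * (real r + 1)\<^sup>2)) ^ n + (3 / 4) ^ r"
proof -
  let ?A = "\<lambda>w. of_bool (\<forall>x. odd (lampcount None w x) = False) * (4 / 3 :: real) ^ maxdisp w"
  have "ret lamplighter n \<le> avg n (\<lambda>w. of_bool (maxdisp w \<le> r) + (3 / 4) ^ r * ?A w)"
    unfolding ret_def
  proof (rule avg_mono)
    fix w :: word
    show "of_bool (lamplighter w []) \<le> of_bool (maxdisp w \<le> r) + (3 / 4) ^ r * ?A w"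
    proof (cases "lamplighter w [] \<and> r < maxdisp w")
      case True
      then have "(4 / 3 :: real) ^ r \<le> (4 / 3) ^ maxdisp w" by (intro power_increasing) auto
      then have "(3 / 4 :: real) ^ r * (4 / 3) ^ r \<le> (3 / 4) ^ r * (4 / 3) ^ maxdisp w"
        by (intro mult_left_mono) auto
      moreover have "(3 / 4 :: real) ^ r * (4 / 3) ^ r = 1" by (simp add: power_mult_distrib[symmetric])
      moreover have "\<forall>x. even (lampcount None w x)" using True by (simp add: lamplighter_def)
      ultimately show ?thesis using True by simp
    qed auto
  qed
  also have "\<dots> = avg n (\<lambda>w. of_bool (maxdisp w \<le> r)) + (3 / 4) ^ r * avg n ?A"
    by (simp only: avg_add avg_cmult)
  also have "\<dots> \<le> 2 * (1 - 1 / (32 * (real r + 1)\<^sup>2)) ^ n + (3 / 4) ^ r * 1"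
    using avg_lampcount_maxdisp_le[of n None "\<lambda>_ _. False"]
    by (intro add_mono avg_confined_le mult_left_mono) auto
  finally show ?thesis by simp
qed

section \<open>Exponential decay from ping-pong\<close>

text \<open>On an infinite support the sum defaults to 0; hence the recurring finiteness
  assumptions.\<close>

definition l2 :: "('a \<Rightarrow> real) \<Rightarrow> real" where
  "l2 f = L2_set f {x. f x \<noteq> 0}"

lemma l2_eq: "finite A \<Longrightarrow> {x. f x \<noteq> 0} \<subseteq> A \<Longrightarrow> l2 f = L2_set f A"
  unfolding l2_def L2_set_def by (intro arg_cong[of _ _ sqrt] sum.mono_neutral_left) auto

lemma l2_nonneg: "0 \<le> l2 f"
  by (simp add: l2_def)

lemma l2_add:
  assumes "finite {x. f x \<noteq> 0}" "finite {x. g x \<noteq> 0}"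
  shows "l2 (\<lambda>x. f x + g x) \<le> l2 f + l2 g"
proof -
  define A where "A = {x. f x \<noteq> 0} \<union> {x. g x \<noteq> 0}"
  have A: "finite A" using assms by (simp add: A_def)
  have "l2 f = L2_set f A" "l2 g = L2_set g A" "l2 (\<lambda>x. f x + g x) = L2_set (\<lambda>x. f x + g x) A"
    by (rule l2_eq[OF A]; force simp: A_def)+
  then show ?thesis by (simp add: L2_set_triangle_ineq)
qed

lemma l2_mono:
  assumes "finite {x. g x \<noteq> 0}" "\<And>x. \<bar>f x\<bar> \<le> \<bar>g x\<bar>"
  shows "l2 f \<le> l2 g"
proof -
  have "f x = 0" if "g x = 0" for x using assms(2)[of x] that by simp
  then have "{x. f x \<noteq> 0} \<subseteq> {x. g x \<noteq> 0}" by auto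
  then have "l2 f = L2_set f {x. g x \<noteq> 0}" using assms(1) by (intro l2_eq)
  then show ?thesis
    using assms(2) by (simp add: l2_def L2_set_def sum_mono abs_le_square_iff[symmetric])
qed

lemma l2_comp:
  assumes "bij p"
  shows "l2 (\<lambda>x. f (p x)) = l2 f"
proof -
  have "bij_betw p {x. f (p x) \<noteq> 0} {x. f x \<noteq> 0}"
    using assms by (auto simp: bij_betw_def inj_on_def bij_def image_iff)
  from sum.reindex_bij_betw[OF this, of "\<lambda>x. (f x)\<^sup>2"]
  show ?thesis by (simp add: l2_def L2_set_def)
qed

lemma finite_support_comp:
  assumes "bij p" "finite {x. f x \<noteq> 0}"
  shows "finite {x. f (p x) \<noteq> (0 :: real)}"
proof -
  have "{x. f (p x) \<noteq> 0} = p -` {x. f x \<noteq> 0}" by auto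
  then show ?thesis using finite_vimageI[OF assms(2) bij_is_inj[OF assms(1)]] by simp
qed

lemma le_l2:
  assumes "finite {x. f x \<noteq> 0}"
  shows "f x \<le> l2 f"
proof (cases "f x = 0")
  case False
  then have "\<bar>f x\<bar> \<le> l2 f" unfolding l2_def
    using member_le_L2_set[of "{x. f x \<noteq> 0}" x "\<lambda>x. \<bar>f x\<bar>"] assms by (simp add: L2_set_def)
  then show ?thesis by simp
qed (simp add: l2_nonneg)

text \<open>The variance is a sum of squared differences over all pairs of indices; only the two
  pairs formed by \<open>e\<close> and \<open>l\<close> are kept.\<close>

lemma mean_square_le:
  fixes a :: "'i :: finite \<Rightarrow> real"
  assumes "e \<noteq> l"
  shows "((\<Sum>i\<in>UNIV. a i) / CARD('i))\<^sup>2 + ((a l - a e) / CARD('i))\<^sup>2 \<le> (\<Sum>i\<in>UNIV. (a i)\<^sup>2) / CARD('i)"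
proof -
  let ?N = "real CARD('i)"
  have N: "?N > 0" by simp
  let ?S = "\<Sum>p\<in>UNIV \<times> UNIV. (a (fst p) - a (snd p))\<^sup>2"
  have "?S = (\<Sum>i\<in>UNIV. \<Sum>j\<in>UNIV. (a i - a j)\<^sup>2)"
    by (simp add: sum.cartesian_product case_prod_beta)
  also have "\<dots> = (\<Sum>i\<in>UNIV. \<Sum>j\<in>UNIV. (a i)\<^sup>2 + (a j)\<^sup>2 - 2 * (a i * a j))"
    by (intro sum.cong refl) (simp add: power2_eq_square algebra_simps)
  also have "\<dots> = 2 * ?N * (\<Sum>i\<in>UNIV. (a i)\<^sup>2) - 2 * (\<Sum>i\<in>UNIV. a i)\<^sup>2"
  proof -
    have "(\<Sum>i\<in>UNIV. \<Sum>j\<in>(UNIV :: 'i set). (a i)\<^sup>2) = ?N * (\<Sum>i\<in>UNIV. (a i)\<^sup>2)"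
      by (simp add: sum_distrib_left)
    moreover have "(\<Sum>i\<in>(UNIV :: 'i set). \<Sum>j\<in>UNIV. (a j)\<^sup>2) = ?N * (\<Sum>i\<in>UNIV. (a i)\<^sup>2)"
      by simp
    moreover have "(\<Sum>i\<in>UNIV. \<Sum>j\<in>UNIV. 2 * (a i * a j)) = 2 * (\<Sum>i\<in>UNIV. a i)\<^sup>2"
      unfolding power2_eq_square by (subst sum_product) (simp add: sum_distrib_left)
    ultimately show ?thesis by (simp add: sum.distrib sum_subtractf)
  qed
  finally have S: "?S = 2 * ?N * (\<Sum>i\<in>UNIV. (a i)\<^sup>2) - 2 * (\<Sum>i\<in>UNIV. a i)\<^sup>2" .
  have "(\<Sum>p\<in>{(l, e), (e, l)}. (a (fst p) - a (snd p))\<^sup>2) \<le> ?S"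
    by (intro sum_mono2) auto
  moreover have "(\<Sum>p\<in>{(l, e), (e, l)}. (a (fst p) - a (snd p))\<^sup>2) = 2 * (a l - a e)\<^sup>2"
    using assms by (simp add: power2_commute)
  ultimately have "(\<Sum>i\<in>UNIV. a i)\<^sup>2 + (a l - a e)\<^sup>2 \<le> ?N * (\<Sum>i\<in>UNIV. (a i)\<^sup>2)"
    using S by simp
  then have "((\<Sum>i\<in>UNIV. a i)\<^sup>2 + (a l - a e)\<^sup>2) / ?N\<^sup>2 \<le> ?N * (\<Sum>i\<in>UNIV. (a i)\<^sup>2) / ?N\<^sup>2"
    by (rule divide_right_mono) simp
  then show ?thesis using N by (simp add: power_divide add_divide_distrib power2_eq_square)
qed

section \<open>Spectral gap for an action that plays ping-pong\<close>

context
  fixes step :: "letter \<Rightarrow> 'a \<Rightarrow> 'a" and u :: "idx \<Rightarrow> word" and P :: "idx \<Rightarrow> 'a set" and L :: nat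
  assumes step_inv: "\<And>l x. step (linv l) (step l x) = x"
    and step_id: "\<And>x. step (None, None, None) x = x"
    and L: "L > 0" "\<And>i. length (u i) \<le> L"
    and disj: "\<And>i j. i \<noteq> j \<Longrightarrow> P i \<inter> P j = {}"
    and pingpong: "\<And>i x. x \<notin> P i \<Longrightarrow> fold step (u i) x \<in> P i"
begin

lemma bij_step: "bij (step l)"
  by (rule o_bij[of "step (linv l)"]) (auto simp: fun_eq_iff step_inv step_inv[of "linv l", simplified])

lemma bij_fold_step: "bij (fold step w)"
proof (induction w)
  case (Cons l w)
  have "fold step (l # w) = fold step w \<circ> step l" by (rule ext) simp
  then show ?case using bij_comp[OF bij_step[of l] Cons] by argo
qed (simp add: id_def[symmetric])

text \<open>Comparing letter \<open>l\<close> with the identity letter in the variance of the 48 translates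
  of \<open>f\<close> quantifies the loss of norm.\<close>

lemma mean_contraction:
  assumes fin: "finite {x. f x \<noteq> 0}" and l: "l \<noteq> (None, None, None)"
  shows "(l2 (\<lambda>x. (\<Sum>l\<in>UNIV. f (step l x)) / 48))\<^sup>2 + (l2 (\<lambda>x. f (step l x) - f x) / 48)\<^sup>2 \<le> (l2 f)\<^sup>2"
proof -
  define A where "A = {x. f x \<noteq> 0} \<union> (\<Union>l\<in>UNIV. {x. f (step l x) \<noteq> 0})"
  have A: "finite A"
    unfolding A_def using fin finite_support_comp[OF bij_step fin] by auto
  have out: "f x = 0 \<and> f (step l x) = 0" if "x \<notin> A" for x l
    using that unfolding A_def by blast
  have l2A: "l2 h = L2_set h A" if "\<And>x. x \<notin> A \<Longrightarrow> h x = 0" for h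
    using that by (intro l2_eq[OF A]) blast
  have mean: "l2 (\<lambda>x. (\<Sum>l\<in>UNIV. f (step l x)) / 48) = L2_set (\<lambda>x. (\<Sum>l\<in>UNIV. f (step l x)) / 48) A"
    by (rule l2A) (simp add: out)
  have diff: "l2 (\<lambda>x. f (step l x) - f x) = L2_set (\<lambda>x. f (step l x) - f x) A"
    by (rule l2A) (simp add: out)
  have same: "(\<Sum>x\<in>A. (f (step l x))\<^sup>2) = (l2 f)\<^sup>2" for l
  proof -
    have "l2 (\<lambda>x. f (step l x)) = L2_set (\<lambda>x. f (step l x)) A"
      by (rule l2A) (simp add: out)
    then show ?thesis
      by (simp add: l2_comp[OF bij_step] L2_set_def sum_nonneg)
  qed
  have "(\<Sum>x\<in>A. ((\<Sum>l\<in>UNIV. f (step l x)) / 48)\<^sup>2 + ((f (step l x) - f x) / 48)\<^sup>2)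
      \<le> (\<Sum>x\<in>A. (\<Sum>l\<in>UNIV. (f (step l x))\<^sup>2) / 48)"
  proof (rule sum_mono)
    fix x
    show "((\<Sum>l\<in>UNIV. f (step l x)) / 48)\<^sup>2 + ((f (step l x) - f x) / 48)\<^sup>2
      \<le> (\<Sum>l\<in>UNIV. (f (step l x))\<^sup>2) / 48"
      using mean_square_le[of "(None, None, None)" l "\<lambda>l. f (step l x)"] l
      by (simp only: card_letter step_id) simp
  qed
  also have "\<dots> = (\<Sum>l\<in>UNIV. (\<Sum>x\<in>A. (f (step l x))\<^sup>2)) / 48"
    by (subst sum.swap) (simp add: sum_divide_distrib)
  also have "\<dots> = (l2 f)\<^sup>2" by (simp add: same card_option)
  finally show ?thesis
    unfolding mean diff by (simp add: L2_set_def sum_nonneg sum.distrib power_divide sum_divide_distrib)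
qed

text \<open>Telescoping along the word; precomposition with a bijection does not change the
  norm.\<close>

lemma l2_word_diff:
  assumes fin: "finite {x. f x \<noteq> 0}" and d: "\<And>l. l2 (\<lambda>x. f (step l x) - f x) \<le> d"
  shows "l2 (\<lambda>x. f (fold step w x) - f x) \<le> real (length w) * d"
proof (induction w)
  case Nil
  show ?case by (simp add: l2_def)
next
  case (Cons l w)
  let ?g = "\<lambda>x. f (fold step w x) - f x"
  have fd: "finite {x. f (p x) - f x \<noteq> 0}" if "bij p" for p
  proof (rule finite_subset)
    show "{x. f (p x) - f x \<noteq> 0} \<subseteq> {x. f (p x) \<noteq> 0} \<union> {x. f x \<noteq> 0}" by auto
    show "finite ({x. f (p x) \<noteq> 0} \<union> {x. f x \<noteq> 0})"
      using fin finite_support_comp[OF that fin] by blast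
  qed
  have "l2 (\<lambda>x. f (fold step (l # w) x) - f x) = l2 (\<lambda>x. ?g (step l x) + (f (step l x) - f x))"
    by simp
  also have "\<dots> \<le> l2 (\<lambda>x. ?g (step l x)) + l2 (\<lambda>x. f (step l x) - f x)"
    by (intro l2_add finite_support_comp[OF bij_step] fd bij_step bij_fold_step)
  also have "\<dots> \<le> real (length w) * d + d"
    using Cons d[of l] l2_comp[OF bij_step, of ?g l] by simp
  finally show ?case by (simp add: algebra_simps)
qed

text \<open>One of the three disjoint sets carries at most a third of the mass of \<open>f\<^sup>2\<close>, but it contains
  a translate of its complement, which carries at least two thirds.\<close>

lemma l2_pingpong:
  assumes fin: "finite {x. f x \<noteq> 0}" and d: "\<And>l. l2 (\<lambda>x. f (step l x) - f x) \<le> d"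
  shows "l2 f \<le> 5 * real L * d"
proof -
  define B where "B = {x. f x \<noteq> 0}"
  have B: "finite B" using fin by (simp add: B_def)
  have total: "(l2 f)\<^sup>2 = (\<Sum>x\<in>B. (f x)\<^sup>2)"
    by (simp add: l2_def L2_set_def B_def sum_nonneg)
  define m where "m i = (\<Sum>x\<in>B \<inter> P i. (f x)\<^sup>2)" for i
  have "(\<Sum>i\<in>UNIV. m i) = (\<Sum>x\<in>(\<Union>i\<in>UNIV. B \<inter> P i). (f x)\<^sup>2)"
    unfolding m_def by (subst sum.UNION_disjoint) (use B disj in auto)
  also have "\<dots> \<le> (l2 f)\<^sup>2" unfolding total by (intro sum_mono2 B) auto
  finally have m3: "m None + m (Some True) + m (Some False) \<le> (l2 f)\<^sup>2"
    by (simp add: UNIV_idx)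
  have "\<exists>i. m i \<le> (l2 f)\<^sup>2 / 3"
  proof (rule ccontr)
    assume "\<nexists>i. m i \<le> (l2 f)\<^sup>2 / 3"
    then have "(l2 f)\<^sup>2 / 3 < m i" for i using not_le by blast
    from this[of None] this[of "Some True"] this[of "Some False"] m3 show False by linarith
  qed
  then obtain i where i: "m i \<le> (l2 f)\<^sup>2 / 3" by blast
  define p where "p = fold step (u i)"
  have p: "bij p" unfolding p_def by (rule bij_fold_step)
  let ?in = "\<lambda>x. if x \<in> P i then f x else 0"
  let ?out = "\<lambda>x. if x \<in> P i then 0 else f x"
  let ?diff = "\<lambda>x. f (p x) - f x"
  have fin1: "finite {x. ?in x \<noteq> 0}" by (rule finite_subset[OF _ B]) (auto simp: B_def)
  have fin3: "finite {x. ?diff x \<noteq> 0}"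
  proof (rule finite_subset)
    show "{x. ?diff x \<noteq> 0} \<subseteq> {x. f (p x) \<noteq> 0} \<union> {x. f x \<noteq> 0}" by auto
    show "finite ({x. f (p x) \<noteq> 0} \<union> {x. f x \<noteq> 0})"
      using fin finite_support_comp[OF p fin] by blast
  qed
  have "l2 ?in = L2_set ?in B" by (rule l2_eq[OF B]) (auto simp: B_def)
  then have l_in: "l2 ?in = sqrt (m i)"
    by (simp add: L2_set_def m_def sum.inter_restrict B if_distrib[of "\<lambda>x. x\<^sup>2"] cong: if_cong)
  have "l2 ?out = L2_set ?out B" by (rule l2_eq[OF B]) (auto simp: B_def)
  moreover have "(\<Sum>x\<in>B. (?out x)\<^sup>2) + m i = (l2 f)\<^sup>2"
    unfolding m_def total sum.inter_restrict[OF B] sum.distrib[symmetric]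
    by (intro sum.cong) auto
  ultimately have l_out: "l2 ?out = sqrt ((l2 f)\<^sup>2 - m i)"
    by (simp add: L2_set_def algebra_simps)
  \<comment> \<open>For \<open>x\<close> outside of \<open>P i\<close> the point \<open>p x\<close>
    lies inside, so \<open>f x\<close> is the value of the inner part at \<open>p x\<close> up to
    the difference \<open>f (p x) - f x\<close>.\<close>
  have "l2 ?out \<le> l2 (\<lambda>x. \<bar>?in (p x)\<bar> + \<bar>?diff x\<bar>)"
  proof (rule l2_mono)
    show "finite {x. \<bar>?in (p x)\<bar> + \<bar>?diff x\<bar> \<noteq> 0}"
    proof (rule finite_subset)
      show "{x. \<bar>?in (p x)\<bar> + \<bar>?diff x\<bar> \<noteq> 0} \<subseteq> {x. ?in (p x) \<noteq> 0} \<union> {x. ?diff x \<noteq> 0}"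
        by auto
      show "finite ({x. ?in (p x) \<noteq> 0} \<union> {x. ?diff x \<noteq> 0})"
        using finite_support_comp[OF p fin1] fin3 by blast
    qed
    show "\<bar>?out x\<bar> \<le> \<bar>\<bar>?in (p x)\<bar> + \<bar>?diff x\<bar>\<bar>" for x
      using pingpong[of x i] by (auto simp: p_def)
  qed
  also have "\<dots> \<le> l2 (\<lambda>x. \<bar>?in (p x)\<bar>) + l2 (\<lambda>x. \<bar>?diff x\<bar>)"
    using finite_support_comp[OF p fin1] fin3 by (intro l2_add) (simp_all only: abs_eq_0 not_False_eq_True)
  also have "\<dots> = l2 (\<lambda>x. ?in (p x)) + l2 ?diff"
    by (simp add: l2_def L2_set_def)
  also have "\<dots> = l2 ?in + l2 ?diff" by (simp only: l2_comp[OF p, of ?in])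
  also have "l2 ?diff \<le> real (length (u i)) * d" unfolding p_def by (rule l2_word_diff[OF fin d])
  also have "\<dots> \<le> real L * d"
    using L(2)[of i] order_trans[OF l2_nonneg d] by (intro mult_right_mono) auto
  finally have main: "sqrt ((l2 f)\<^sup>2 - m i) \<le> sqrt (m i) + real L * d"
    by (simp add: l_in l_out)
  have s0: "0 \<le> l2 f" by (rule l2_nonneg)
  have sq: "0 \<le> (l2 f)\<^sup>2" by simp
  \<comment> \<open>With at most a third of the mass inside, the two roots compare with 4/5 and 3/5
    since 16/25 < 2/3 and 1/3 < 9/25. The gap 1/5 is the origin of the factor 5.\<close>
  have "l2 f * (4 / 5) = sqrt ((l2 f * (4 / 5))\<^sup>2)" using s0 by simp
  also have "\<dots> \<le> sqrt ((l2 f)\<^sup>2 - m i)"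
    using i by (intro real_sqrt_le_mono) (simp add: power_mult_distrib power_divide, use sq in linarith)
  finally have 1: "l2 f * (4 / 5) \<le> sqrt ((l2 f)\<^sup>2 - m i)" .
  have "sqrt (m i) \<le> sqrt ((l2 f * (3 / 5))\<^sup>2)"
    using i by (intro real_sqrt_le_mono) (simp add: power_mult_distrib power_divide, use sq in linarith)
  also have "\<dots> = l2 f * (3 / 5)" using s0 by simp
  finally show ?thesis using 1 main by simp
qed

text \<open>The letter that moves \<open>f\<close> most moves it by at least
  \<open>l2 f / (5 * L)\<close>, and comparing it with the identity letter gives the loss; 240 = 5 *
  48.\<close>

lemma l2_mean_le:
  assumes fin: "finite {x. f x \<noteq> 0}"
  shows "l2 (\<lambda>x. (\<Sum>l\<in>UNIV. f (step l x)) / 48) \<le> sqrt (1 - (1 / (240 * real L))\<^sup>2) * l2 f"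
proof -
  define d where "d l = l2 (\<lambda>x. f (step l x) - f x)" for l
  have "Max (range d) \<in> range d" by (intro Max_in) auto
  then obtain l where "d l = Max (range d)" by (metis imageE)
  then have l: "d l' \<le> d l" for l' by simp
  have 1: "l2 f \<le> 5 * real L * d l"
    by (rule l2_pingpong[OF fin]) (use l in \<open>simp add: d_def\<close>)
  have "(l2 (\<lambda>x. (\<Sum>l\<in>UNIV. f (step l x)) / 48))\<^sup>2 + (l2 f / (240 * real L))\<^sup>2 \<le> (l2 f)\<^sup>2"
  \<comment> \<open>If even the identity letter moves \<open>f\<close> most, then nothing moves it
    and its norm is 0.\<close>
  proof (cases "l = (None, None, None)")
    case True
    then have "d l = 0" by (simp add: d_def step_id l2_def)
    then have "l2 f = 0" using 1 l2_nonneg[of f] by simp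
    moreover have neq: "(None, Some True, None) \<noteq> ((None, None, None) :: letter)" by simp
    have "(l2 (\<lambda>x. (\<Sum>l\<in>UNIV. f (step l x)) / 48))\<^sup>2 \<le> (l2 f)\<^sup>2"
      using mean_contraction[OF fin, of "(None, Some True, None)", OF neq]
        zero_le_power2[of "l2 (\<lambda>x. f (step (None, Some True, None) x) - f x) / 48"] by linarith
    ultimately show ?thesis by simp
  next
    case False
    have "l2 f / (240 * real L) \<le> d l / 48"
      using 1 L(1) by (simp add: field_simps)
    then have "(l2 f / (240 * real L))\<^sup>2 \<le> (d l / 48)\<^sup>2"
      using l2_nonneg[of f] by (intro power_mono) auto
    then show ?thesis using mean_contraction[OF fin False] by (simp add: d_def)
  qed
  then have "(l2 (\<lambda>x. (\<Sum>l\<in>UNIV. f (step l x)) / 48))\<^sup>2 \<le> (1 - (1 / (240 * real L))\<^sup>2) * (l2 f)\<^sup>2"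
    by (simp add: power_divide algebra_simps)
  then have "sqrt ((l2 (\<lambda>x. (\<Sum>l\<in>UNIV. f (step l x)) / 48))\<^sup>2)
      \<le> sqrt ((1 - (1 / (240 * real L))\<^sup>2) * (l2 f)\<^sup>2)"
    by (rule real_sqrt_le_mono)
  then show ?thesis by (simp add: real_sqrt_mult l2_nonneg)
qed

text \<open>The distribution after \<open>n\<close> steps evolves by averaging over translates,
  because \<open>linv\<close> permutes the letters. It starts with norm 1, and each of its values is
  at most its norm.\<close>

lemma pingpong_decay:
  "avg n (\<lambda>w. of_bool (fold step w x0 = x)) \<le> sqrt (1 - (1 / (240 * real L))\<^sup>2) ^ n"
proof -
  let ?q = "sqrt (1 - (1 / (240 * real L))\<^sup>2)"
  define f where "f n x = avg n (\<lambda>w. of_bool (fold step w x0 = x))" for n x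
  have fin: "finite {x. f n x \<noteq> 0}" for n
  proof (rule finite_subset)
    show "{x. f n x \<noteq> 0} \<subseteq> (\<lambda>w. fold step w x0) ` {w. length w = n}"
    proof
      fix x assume x: "x \<in> {x. f n x \<noteq> 0}"
      show "x \<in> (\<lambda>w. fold step w x0) ` {w. length w = n}"
      proof (rule ccontr)
        assume "x \<notin> (\<lambda>w. fold step w x0) ` {w. length w = n}"
        then have "f n x = avg n (\<lambda>w. 0)" unfolding f_def by (intro avg_cong) auto
        then show False using x by (simp add: avg_const)
      qed
    qed
  qed (simp add: finite_words)
  have Suc: "f (Suc n) x = (\<Sum>l\<in>UNIV. f n (step l x)) / 48" for n x
  proof -
    have eq: "step l y = x \<longleftrightarrow> y = step (linv l) x" for l y
      using step_inv[of l y] step_inv[of "linv l" x] by auto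
    have "f (Suc n) x = avg n (\<lambda>w. 1 / 48 * (\<Sum>l\<in>UNIV. of_bool (fold step w x0 = step (linv l) x)))"
      unfolding f_def by (simp add: avg_Suc eq)
    also have "\<dots> = (\<Sum>l\<in>UNIV. f n (step (linv l) x)) / 48"
      unfolding avg_cmult avg_sum f_def by simp
    also have "(\<Sum>l\<in>UNIV. f n (step (linv l) x)) = (\<Sum>l\<in>UNIV. f n (step l x))"
      using sum.reindex_bij_betw[OF bij_linv, of "\<lambda>l. f n (step l x)"] by simp
    finally show ?thesis .
  qed
  have q: "0 \<le> ?q"
  proof -
    have "1 / (240 * real L) \<le> 1" using L(1) by (simp add: divide_le_eq)
    then show ?thesis by (simp add: power_le_one)
  qed
  have "l2 (f n) \<le> ?q ^ n"
  proof (induction n)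
    case 0
    have "f 0 = (\<lambda>x. of_bool (x = x0))" by (auto simp: f_def fun_eq_iff)
    then show ?case by (simp add: l2_def)
  next
    case (Suc n)
    have "l2 (f (Suc n)) = l2 (\<lambda>x. (\<Sum>l\<in>UNIV. f n (step l x)) / 48)"
      using \<open>\<And>n x. f (Suc n) x = (\<Sum>l\<in>UNIV. f n (step l x)) / 48\<close> by presburger
    also have "\<dots> \<le> ?q * l2 (f n)" by (rule l2_mean_le[OF fin])
    also have "\<dots> \<le> ?q * ?q ^ n" using Suc q by (intro mult_left_mono)
    finally show ?case by simp
  qed
  then show ?thesis using le_l2[OF fin, of n x] unfolding f_def by linarith
qed

end

section \<open>Ping-pong for the offset lamps\<close>

text \<open>Ping-pong is played on the state of the lamp under the cursor.\<close>

definition cstep :: "int \<Rightarrow> letter \<Rightarrow> int \<times> (int \<Rightarrow> idx list) \<Rightarrow> int \<times> (int \<Rightarrow> idx list)" where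
  "cstep k l = (\<lambda>(s, F). (s + disp [l], \<lambda>x. fold flip (fired (\<lambda>i x. x = k * mv i) [l] (x + s)) (F x)))"

lemma fold_cstep: "fold (cstep k) w (s, F) =
    (s + disp w, \<lambda>x. fold flip (fired (\<lambda>i x. x = k * mv i) w (x + s)) (F x))"
proof (induction w arbitrary: s F)
  case (Cons l w)
  have "fold (cstep k) (l # w) (s, F) = fold (cstep k) w (cstep k l (s, F))" by simp
  also have "\<dots> = (s + disp ([l] @ w),
      \<lambda>x. fold flip (fired (\<lambda>i x. x = k * mv i) ([l] @ w) (x + s)) (F x))"
    unfolding fired_append by (simp add: cstep_def Cons add.assoc disp_Cons)
  finally show ?case by simp
qed simp

lemma fired_replicate_move: "fired F (replicate n (None, m, None)) x = []"
  by (induction n arbitrary: x) (auto simp: firing_def)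

lemma disp_replicate: "disp (replicate n (a, m, b)) = int n * mv m"
  by (induction n) (auto simp: disp_Cons algebra_simps)

text \<open>All targets \<open>v\<close> are covered, not only the identity, because linear speed
  needs them. The rate depends on \<open>k\<close> only and serves every congruence finer than
  \<open>offset_lamps k\<close>.\<close>

lemma offset_lamps_decay:
  assumes "k > 0"
  shows "\<exists>q. 0 < q \<and> q < 1 \<and>
    (\<forall>R n v. (\<forall>w v. R w v \<longrightarrow> offset_lamps k w v) \<longrightarrow> avg n (\<lambda>w. of_bool (R v w)) \<le> q ^ n)"
proof -
  define L where "L = 2 * nat k + 1"
  define q where "q = sqrt (1 - (1 / (240 * real L))\<^sup>2)"
  let ?G = "\<lambda>i x. x = k * mv i"
  \<comment> \<open>Moving \<open>k\<close> steps in direction \<open>i\<close>, toggling and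
    returning applies the generator \<open>i\<close> to the fibre under the cursor and nothing else
    to that fibre.\<close>
  define u :: "idx \<Rightarrow> word" where "u i = replicate (nat k) (None, i, None) @ [(Some i, None, None)]
    @ replicate (nat k) (None, map_option Not i, None)" for i
  define P :: "idx \<Rightarrow> (int \<times> (int \<Rightarrow> idx list)) set" where
    "P i = {(s, F). odd (length (takeWhile ((=) i) (F (- s))))}" for i
  have inv: "cstep k (linv l) (cstep k l y) = y" for l y
  proof -
    obtain s F where y: "y = (s, F)" by (cases y)
    have "cstep k (linv l) (cstep k l y) = fold (cstep k) ([l] @ winv [l]) y"
      by (simp add: winv_Cons)
    moreover have "disp ([l] @ winv [l]) = 0" by (simp only: disp_append disp_winv)
    then have "fold (cstep k) ([l] @ winv [l]) y = y" unfolding y fold_cstep fired_append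
      by (simp add: fired_winv fold_involution del: disp_append)
    ultimately show ?thesis by simp
  qed
  have id: "cstep k (None, None, None) y = y" for y
    by (cases y) (simp add: cstep_def disp_Cons firing_def)
  have disj: "P i \<inter> P j = {}" if "i \<noteq> j" for i j
  proof -
    have "\<not> (odd (length (takeWhile ((=) i) y)) \<and> odd (length (takeWhile ((=) j) y)))" for y
      using that by (cases y) auto
    then show ?thesis unfolding P_def by blast
  qed
  have pp: "fold (cstep k) (u i) y \<in> P i" if "y \<notin> P i" for i y
  proof -
    obtain s F where y: "y = (s, F)" by (cases y)
    have "fired ?G (u i) 0 = [i]"
      using assms by (simp add: u_def fired_append fired_replicate_move disp_replicate firing_def)
    moreover have "disp (u i) = 0"
      by (simp add: u_def disp_replicate disp_Cons)
    ultimately have "fold (cstep k) (u i) y = (s, \<lambda>x. fold flip (fired ?G (u i) (x + s)) (F x))"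
      and "fold flip (fired ?G (u i) (- s + s)) (F (- s)) = flip i (F (- s))"
      unfolding y fold_cstep by simp_all
    then show ?thesis using that by (auto simp: y P_def flip_def)
  qed
  have decay: "avg n (\<lambda>w. of_bool (fold (cstep k) w x0 = x)) \<le> q ^ n" for n x0 x
    unfolding q_def
    by (rule pingpong_decay[of "cstep k" L u P]) (use inv id disj pp in \<open>auto simp: L_def u_def\<close>)
  have "avg n (\<lambda>w. of_bool (R v w)) \<le> q ^ n" if R: "\<forall>w v. R w v \<longrightarrow> offset_lamps k w v" for R n v
  proof -
    let ?o = "(0 :: int, \<lambda>_ :: int. [] :: idx list)"
    have "avg n (\<lambda>w. of_bool (R v w)) \<le>
        avg n (\<lambda>w. of_bool (fold (cstep k) w ?o = fold (cstep k) v ?o))"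
    proof (rule avg_mono)
      fix w
      have "fold (cstep k) w ?o = fold (cstep k) v ?o" if "R v w"
        using R[rule_format, OF that] unfolding fold_cstep offset_lamps_def Rel_def by (simp add: toggle_UNIV)
      then show "of_bool (R v w) \<le> (of_bool (fold (cstep k) w ?o = fold (cstep k) v ?o) :: real)"
        by simp
    qed
    then show ?thesis using decay[of n ?o "fold (cstep k) v ?o"] by simp
  qed
  moreover have "0 < q" "q < 1"
  proof -
    have "0 < 1 / (240 * real L)" "1 / (240 * real L) < 1" by (auto simp: L_def divide_less_eq)
    then have "0 < (1 / (240 * real L))\<^sup>2" "(1 / (240 * real L))\<^sup>2 < 1"
      by (auto simp: power_less_one_iff)
    then show "0 < q" "q < 1" unfolding q_def by auto
  qed
  ultimately show ?thesis by blast
qed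

section \<open>Finite extensions of the lamplighter group\<close>

text \<open>Confined walks reach few group elements, so by Cauchy-Schwarz two independent copies
  meet with a good probability.\<close>

lemma ret_confined_le:
  assumes "fin_ext R"
  shows "\<exists>C\<ge>1. \<forall>n r. (avg n (\<lambda>w. of_bool (maxdisp w \<le> r)))\<^sup>2
    \<le> C * (2 * real r + 1) * 2 ^ (3 * (2 * r + 1)) * ret R (n + n)"
proof -
  obtain h :: "word \<Rightarrow> nat" where h: "finite (range h)"
    "\<And>w v. lamplighter w v \<Longrightarrow> h w = h v \<Longrightarrow> R w v" and M: "marked R"
    using assms unfolding fin_ext_def by blast
  define C where "C = real (card (range h))"
  have "card (range h) \<noteq> 0" using h(1) by simp
  then have C1: "C \<ge> 1" unfolding C_def by linarith
  have "(avg n (\<lambda>w. of_bool (maxdisp w \<le> r)))\<^sup>2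
    \<le> C * (2 * real r + 1) * 2 ^ (3 * (2 * r + 1)) * ret R (n + n)" for n r
  proof -
    let ?I = "{- int r..int r}"
    \<comment> \<open>For words confined to [-r, r], a complete invariant of the group element:
      displacement, the \<open>3 * (2 * r + 1)\<close> lamps in reach, and the number of the kernel
      part.\<close>
    define J where "J w = (disp w, {p \<in> UNIV \<times> ?I. odd (lampcount (fst p) w (snd p))}, h w)" for w
    define T where "T = ?I \<times> Pow ((UNIV :: idx set) \<times> ?I) \<times> range h"
    have T: "finite T" unfolding T_def using h(1) by simp
    have "card T = (2 * r + 1) * (2 ^ (3 * (2 * r + 1)) * card (range h))"
      unfolding T_def by (simp add: card_cartesian_product card_Pow card_option nat_add_distrib nat_mult_distrib)
    then have cT: "real (card T) = C * (2 * real r + 1) * 2 ^ (3 * (2 * r + 1))"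
      unfolding C_def by (simp add: algebra_simps)
    define q where "q c = avg n (\<lambda>w. of_bool (maxdisp w \<le> r \<and> J w = c))" for c
    have J: "R w v" if "J w = J v" "maxdisp w \<le> r" "maxdisp v \<le> r" for w v
    proof (rule h(2))
      have "even (lampcount i w x) = even (lampcount i v x)" for i x
      proof (cases "x \<in> ?I")
        case True
        have "(i, x) \<in> {p \<in> UNIV \<times> ?I. odd (lampcount (fst p) w (snd p))} \<longleftrightarrow>
          (i, x) \<in> {p \<in> UNIV \<times> ?I. odd (lampcount (fst p) v (snd p))}"
          using that(1) unfolding J_def by blast
        then show ?thesis using True by simp
      next
        case False
        then have "\<bar>x\<bar> > int (maxdisp w)" "\<bar>x\<bar> > int (maxdisp v)" using that by auto
        then show ?thesis by (simp add: lampcount_eq_0)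
      qed
      then show "lamplighter w v" using that by (simp add: lamplighter_def J_def)
      show "h w = h v" using that by (simp add: J_def)
    qed
    have JT: "J w \<in> T" if "maxdisp w \<le> r" for w
      using that disp_le_maxdisp[of w] unfolding J_def T_def by auto
    have delta: "(\<Sum>c\<in>T. of_bool (j = c) :: real) = 1" if "j \<in> T" for j
      using T that by (simp add: of_bool_def)
    have "avg n (\<lambda>w. of_bool (maxdisp w \<le> r)) = avg n (\<lambda>w. \<Sum>c\<in>T. of_bool (maxdisp w \<le> r \<and> J w = c))"
    proof (rule avg_cong)
      fix w
      show "of_bool (maxdisp w \<le> r) = (\<Sum>c\<in>T. of_bool (maxdisp w \<le> r \<and> J w = c) :: real)"
      proof (cases "maxdisp w \<le> r")
        case True
        then show ?thesis using delta[OF JT, of w] by simp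
      qed simp
    qed
    also have "\<dots> = (\<Sum>c\<in>T. q c)" unfolding avg_sum q_def ..
    finally have "(avg n (\<lambda>w. of_bool (maxdisp w \<le> r)))\<^sup>2 = (\<Sum>c\<in>T. q c)\<^sup>2" by simp
    also have "\<dots> \<le> (\<Sum>c\<in>T. (q c)\<^sup>2) * card T" by (rule sum_squared_le_sum_of_squares)
    also have "\<dots> \<le> ret R (n + n) * card T"
    proof (rule mult_right_mono)
      have qq: "avg n (\<lambda>w. avg n (\<lambda>v. of_bool (maxdisp w \<le> r \<and> J w = c) * of_bool (maxdisp v \<le> r \<and> J v = c)))
          = (q c)\<^sup>2" for c
        unfolding avg_cmult q_def[symmetric]
        by (subst mult.commute) (simp only: avg_cmult q_def[symmetric] power2_eq_square)
      have "(\<Sum>c\<in>T. (q c)\<^sup>2) = avg n (\<lambda>w. avg n (\<lambda>v. \<Sum>c\<in>T.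
          of_bool (maxdisp w \<le> r \<and> J w = c) * of_bool (maxdisp v \<le> r \<and> J v = c)))"
        unfolding avg_sum qq ..
      also have "\<dots> \<le> avg n (\<lambda>w. avg n (\<lambda>v. of_bool (R w v)))"
      proof (intro avg_mono)
        fix w v
        show "(\<Sum>c\<in>T. of_bool (maxdisp w \<le> r \<and> J w = c) * of_bool (maxdisp v \<le> r \<and> J v = c))
          \<le> (of_bool (R w v) :: real)"
        proof (cases "maxdisp w \<le> r \<and> maxdisp v \<le> r \<and> J w = J v")
          case True
          then have "(\<Sum>c\<in>T. of_bool (J v = c) :: real) = 1" by (intro delta JT) simp
          moreover have "R w v" using J True by blast
          ultimately show ?thesis using True by (simp add: of_bool_conj[symmetric])
        next
          case False
          then have "(\<Sum>c\<in>T. of_bool (maxdisp w \<le> r \<and> J w = c) * of_bool (maxdisp v \<le> r \<and> J v = c)) = (0 :: real)"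
            by (intro sum.neutral) auto
          then show ?thesis by simp
        qed
      qed
      \<comment> \<open>Two copies meet if and only if \<open>w @ winv v\<close> is trivial, and
        \<open>winv v\<close> is as uniformly distributed as \<open>v\<close>; this turns the
        collision into a return at time \<open>n + n\<close>.\<close>
      also have "\<dots> = avg n (\<lambda>w. avg n (\<lambda>v. of_bool (R (w @ winv v) [])))"
        using marked_iff[OF M] by simp
      also have "\<dots> = avg n (\<lambda>w. avg n (\<lambda>v. of_bool (R (w @ v) [])))"
        using avg_winv[of n "\<lambda>v. of_bool (R (_ @ v) [])"] by simp
      also have "\<dots> = ret R (n + n)" unfolding ret_def avg_append ..
      finally show "(\<Sum>c\<in>T. (q c)\<^sup>2) \<le> ret R (n + n)" .
    qed simp
    finally show ?thesis unfolding cT by (simp add: mult.commute)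
  qed
  then show ?thesis using C1 by blast
qed

text \<open>Append the identity letter. This carries bounds from even to odd times.\<close>

lemma ret_Suc_ge:
  assumes "marked R"
  shows "ret R n / 48 \<le> ret R (Suc n)"
proof -
  have "avg n (\<lambda>w. 1 / 48 * of_bool (R w [])) \<le> ret R (Suc n)"
    unfolding ret_def avg_Suc
  proof (rule avg_mono)
    fix w
    have "R (w @ [(None, None, None)]) []" if "R w []"
      using marked_append[OF assms that marked_id[OF assms]] by simp
    then have "of_bool (R w []) \<le> (of_bool (R (w @ [(None, None, None)]) []) :: real)" by simp
    also have "\<dots> \<le> (\<Sum>l\<in>UNIV. of_bool (R (w @ [l]) []))"
      by (rule member_le_sum) auto
    finally show "1 / 48 * of_bool (R w []) \<le> ((\<Sum>l\<in>UNIV. of_bool (R (w @ [l]) [])) / 48 :: real)"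
      by simp
  qed
  then show ?thesis unfolding avg_cmult by (simp add: ret_def)
qed

lemma ret_ge: assumes "marked R" shows "(1 / 48) ^ n \<le> ret R n"
proof (induction n)
  case 0
  show ?case by (simp add: ret_def marked_refl[OF assms])
next
  case (Suc n)
  then show ?case using ret_Suc_ge[OF assms, of n] by simp
qed

lemma ret_le_1: "ret R n \<le> 1"
  unfolding ret_def using avg_mono[of n "\<lambda>w. of_bool (R w [])" "\<lambda>_. 1"] by (simp add: avg_const)

lemma exp_le_one_minus:
  assumes "0 \<le> x" "x \<le> 1 / 2" shows "exp (- 2 * x) \<le> 1 - (x :: real)"
proof -
  have "- 2 * x \<le> ln (1 - x)"
  proof -
    have "x * x \<le> x * (1 / 2)" using assms by (intro mult_left_mono)
    moreover have "- x - 2 * (x * x) \<le> ln (1 - x)"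
      using ln_one_minus_pos_lower_bound[of x] assms by (simp add: power2_eq_square)
    ultimately show ?thesis by linarith
  qed
  then have "exp (- 2 * x) \<le> exp (ln (1 - x))" by (simp only: exp_le_cancel_iff)
  then show ?thesis using assms by simp
qed

text \<open>With \<open>r\<close> of order \<open>N powr (1 / 3)\<close>, both the cost N / r^2 of
  confinement and the logarithm of the number of reachable elements, which is O(r), are of order
  \<open>N powr (1 / 3)\<close>.\<close>

lemma neg_ln_ret_fin_ext_le:
  assumes "fin_ext R"
  shows "\<exists>C>0. \<forall>n\<ge>1. - ln (ret R n) \<le> C * real n powr (1 / 3)"
proof -
  have M: "marked R" using assms by (simp add: fin_ext_def)
  obtain C where C: "C \<ge> 1" "\<And>n r. (avg n (\<lambda>w. of_bool (maxdisp w \<le> r)))\<^sup>2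
    \<le> C * (2 * real r + 1) * 2 ^ (3 * (2 * r + 1)) * ret R (n + n)"
    using ret_confined_le[OF assms] by blast
  have "- ln (ret R N) \<le> (22 + ln C + ln 48) * real N powr (1 / 3)" if N: "N \<ge> 1" for N
  proof -
    define a where "a = real N powr (1 / 3)"
    define r where "r = nat \<lceil>a\<rceil>"
    define n where "n = N div 2"
    have a1: "a \<ge> 1" unfolding a_def using N by (simp add: ge_one_powr_ge_zero)
    have a3: "a ^ 3 = N" unfolding a_def using N by (simp add: powr_realpow[symmetric] powr_powr)
    have r: "a \<le> real r" "real r \<le> 2 * a" "r > 0" unfolding r_def using a1 by linarith+
    have "exp (- a) \<le> exp (- (2 * real n / a\<^sup>2))"
    proof -
      have "2 * real n / a\<^sup>2 \<le> a ^ 3 / a\<^sup>2" unfolding a3 n_def by (intro divide_right_mono) auto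
      also have "\<dots> = a" using a1 by (simp add: power2_eq_square power3_eq_cube)
      finally show ?thesis by simp
    qed
    also have "\<dots> = exp (- 2 * (1 / a\<^sup>2)) ^ n" by (simp add: exp_of_nat_mult[symmetric] mult.commute)
    also have "\<dots> \<le> exp (- 2 * (1 / (real r + 1)\<^sup>2)) ^ n"
    proof (rule power_mono)
      have "1 / (real r + 1)\<^sup>2 \<le> 1 / a\<^sup>2"
        using r a1 by (intro divide_left_mono power_mono) auto
      then show "exp (- 2 * (1 / a\<^sup>2)) \<le> exp (- 2 * (1 / (real r + 1)\<^sup>2))" by simp
    qed simp
    also have "\<dots> \<le> (1 - 1 / (real r + 1)\<^sup>2) ^ n"
    proof (rule power_mono[OF exp_le_one_minus])
      have "2\<^sup>2 \<le> (real r + 1)\<^sup>2" using r by (intro power_mono) auto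
      then show "1 / (real r + 1)\<^sup>2 \<le> 1 / 2" by (simp add: divide_le_eq)
    qed auto
    also have "\<dots> \<le> avg n (\<lambda>w. of_bool (maxdisp w \<le> r))" by (rule avg_confined_ge[OF r(3)])
    finally have "(exp (- a))\<^sup>2 \<le> (avg n (\<lambda>w. of_bool (maxdisp w \<le> r)))\<^sup>2"
      by (rule power_mono) simp
    also have "\<dots> \<le> C * ((2 * real r + 1) * 2 ^ (3 * (2 * r + 1))) * ret R (n + n)"
      using C(2)[of n r] by (simp add: mult.assoc)
    also have "\<dots> \<le> C * exp (20 * a) * ret R (n + n)"
    proof (intro mult_right_mono mult_left_mono)
      have "2 * real r + 1 \<le> exp (2 * real r + 1)"
        using exp_ge_add_one_self[of "2 * real r + 1"] by linarith
      moreover have "2 ^ (3 * (2 * r + 1)) \<le> exp (3 * (2 * real r + 1))"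
      proof -
        have "(2 :: real) ^ (3 * (2 * r + 1)) \<le> exp 1 ^ (3 * (2 * r + 1))"
          using exp_ge_add_one_self[of 1] by (intro power_mono) auto
        also have "\<dots> = exp (3 * (2 * real r + 1))"
          by (simp add: exp_of_nat_mult[symmetric] algebra_simps)
        finally show ?thesis .
      qed
      ultimately have "(2 * real r + 1) * 2 ^ (3 * (2 * r + 1))
          \<le> exp (2 * real r + 1) * exp (3 * (2 * real r + 1))"
        by (intro mult_mono) auto
      also have "\<dots> = exp (8 * real r + 4)" by (simp add: exp_add[symmetric] algebra_simps)
      also have "\<dots> \<le> exp (20 * a)" using r a1 by simp
      finally show "(2 * real r + 1) * 2 ^ (3 * (2 * r + 1)) \<le> exp (20 * a)" .
    qed (use C(1) order_trans[OF _ ret_ge[OF M, of "n + n"]] in auto)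
    also have "\<dots> \<le> C * exp (20 * a) * (48 * ret R N)"
    proof (rule mult_left_mono)
      have "N = n + n \<or> N = Suc (n + n)" unfolding n_def by presburger
      then show "ret R (n + n) \<le> 48 * ret R N"
        using ret_Suc_ge[OF M, of "n + n"] order_trans[OF _ ret_ge[OF M, of N]] by auto
    qed (use C(1) in auto)
    finally have le: "(exp (- a))\<^sup>2 \<le> C * exp (20 * a) * (48 * ret R N)" .
    have p: "ret R N > 0" using ret_ge[OF M, of N] by (smt (verit) zero_less_power divide_pos_pos)
    have "- 2 * a = ln ((exp (- a))\<^sup>2)" by (simp add: ln_realpow)
    also have "\<dots> \<le> ln (C * exp (20 * a) * (48 * ret R N))"
      using le by (subst ln_le_cancel_iff) (use C(1) p in auto)
    also have "\<dots> = ln C + 20 * a + (ln 48 + ln (ret R N))"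
      using C(1) p by (simp add: ln_mult)
    finally have "- ln (ret R N) \<le> 22 * a + (ln C + ln 48)" by simp
    also have "\<dots> \<le> 22 * a + (ln C + ln 48) * a"
      using C(1) a1 mult_left_mono[of 1 a "ln C + ln 48"] by simp
    finally show ?thesis by (simp add: a_def algebra_simps)
  qed
  moreover have "22 + ln C + ln 48 > 0" using C(1) by (intro add_pos_pos add_pos_nonneg) auto
  ultimately show ?thesis by blast
qed

text \<open>Four letters per site: one for each of the three lamps and one to move on.\<close>

lemma exists_sweep:
  "\<exists>v. length v = 4 * n \<and> disp v = int n \<and>
    (\<forall>i x. odd (lampcount i v x) \<longleftrightarrow> 0 \<le> - x \<and> - x < int n \<and> B i (- x))"
proof (induction n)
  case 0
  show ?case by (intro exI[of _ "[]"]) auto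
next
  case (Suc n)
  then obtain v where v0: "length v = 4 * n \<and> disp v = int n \<and>
    (\<forall>i x. odd (lampcount i v x) \<longleftrightarrow> 0 \<le> - x \<and> - x < int n \<and> B i (- x))" ..
  then have v: "length v = 4 * n" "disp v = int n"
    "odd (lampcount i v x) \<longleftrightarrow> 0 \<le> - x \<and> - x < int n \<and> B i (- x)" for i x by simp_all
  define t :: "idx \<Rightarrow> letter" where "t i = (if B i n then Some i else None, None, None)" for i
  define u where "u = [t None, t (Some True), t (Some False), (None, Some True, None)]"
  have u: "lampcount i u x = of_bool (x = 0 \<and> B i n)" for i x
  proof -
    have "i \<in> {None, Some True, Some False}" using UNIV_idx by blast
    then show ?thesis by (elim insertE emptyE) (simp_all add: u_def t_def lampcount_def firing_def)
  qed
  have "odd (lampcount i (v @ u) x) \<longleftrightarrow> 0 \<le> - x \<and> - x < int (Suc n) \<and> B i (- x)" for i x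
  proof (cases "x = - int n")
    case True
    then show ?thesis using v(3)[of i x] by (auto simp: lampcount_append v(2) u)
  next
    case False
    then show ?thesis using v(3)[of i x] by (auto simp: lampcount_append v(2) u)
  qed
  moreover have "length (v @ u) = 4 * Suc n" "disp (v @ u) = int (Suc n)"
    using v by (auto simp: u_def t_def disp_Cons)
  ultimately show ?case by blast
qed

text \<open>Move to the left end of the range, sweep to the right while switching the lamps, return.\<close>

lemma exists_short_lamplighter: "\<exists>v. lamplighter v w \<and> length v \<le> 11 * (maxdisp w + 1)"
proof -
  define r where "r = maxdisp w"
  obtain s where s0: "length s = 4 * (2 * r + 1) \<and> disp s = int (2 * r + 1) \<and> (\<forall>i x.
    odd (lampcount i s x) \<longleftrightarrow> 0 \<le> - x \<and> - x < int (2 * r + 1) \<and> odd (lampcount i w (int r - (- x))))"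
    using exists_sweep[of "2 * r + 1" "\<lambda>i p. odd (lampcount i w (int r - p))"] ..
  then have s: "length s = 4 * (2 * r + 1)" "disp s = int (2 * r + 1)"
    "odd (lampcount i s x) \<longleftrightarrow> 0 \<le> - x \<and> - x < int (2 * r + 1) \<and> odd (lampcount i w (int r - (- x)))"
    for i x by blast+
  define bk where "bk k = replicate k (None :: idx option, Some False, None :: idx option)" for k
  \<comment> \<open>The sweep runs from \<open>- r\<close> to \<open>r + 1\<close>, one past the
    range, and \<open>b\<close> steps lead back to \<open>disp w\<close>. The total is at most r + 4
    * (2 * r + 1) + (2 * r + 1), hence the factor 11.\<close>
  define b where "b = nat (int r + 1 - disp w)"
  have d: "\<bar>disp w\<bar> \<le> int r" using disp_le_maxdisp[of w] by (simp add: r_def)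
  have b: "int b = int r + 1 - disp w" unfolding b_def using d by simp
  have bk: "disp (bk k) = - int k" "lampcount i (bk k) x = 0" for k i x
    by (simp_all add: bk_def disp_replicate lampcount_def fired_replicate_move)
  define v where "v = bk r @ s @ bk b"
  have "disp v = disp w" by (simp add: v_def bk s b)
  moreover have "even (lampcount i v x) = even (lampcount i w x)" for i x
  proof (cases "\<bar>x\<bar> \<le> int r")
    case True
    then show ?thesis using s(3)[of i "x - int r"] by (auto simp: v_def lampcount_append bk)
  next
    case False
    then have "lampcount i w x = 0" by (intro lampcount_eq_0) (simp add: r_def)
    then show ?thesis using s(3)[of i "x - int r"] by (auto simp: v_def lampcount_append bk)
  qed
  moreover have "length v \<le> 11 * (r + 1)"
    using d b by (simp add: v_def s bk_def) 
  ultimately show ?thesis unfolding lamplighter_def r_def by blast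
qed

text \<open>A short word with the same image in the lamplighter group differs from \<open>w\<close>
  by an element of the finite kernel, whose elements have representatives of bounded length.\<close>

lemma mnorm_fin_ext_le:
  assumes "fin_ext R"
  shows "\<exists>C. \<forall>w. mnorm R w \<le> C + 11 * (maxdisp w + 1)"
proof -
  obtain h :: "word \<Rightarrow> nat" where h: "finite (range h)"
    "\<And>w v. lamplighter w v \<Longrightarrow> h w = h v \<Longrightarrow> R w v" and M: "marked R"
    using assms unfolding fin_ext_def by blast
  define rep where "rep c = (SOME u. lamplighter u [] \<and> h u = c)" for c
  define C where "C = Max (length ` rep ` range h)"
  have "mnorm R w \<le> C + 11 * (maxdisp w + 1)" for w
  proof -
    obtain v where v: "lamplighter v w" "length v \<le> 11 * (maxdisp w + 1)" using exists_short_lamplighter by blast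
    define z where "z = w @ winv v"
    have z: "lamplighter z []"
      unfolding z_def using marked_iff[OF marked_lamplighter] marked_sym[OF marked_lamplighter v(1)] by blast
    have rep: "lamplighter (rep (h z)) [] \<and> h (rep (h z)) = h z"
      unfolding rep_def by (rule someI[where P = "\<lambda>u. lamplighter u [] \<and> h u = h z" and x = z]) (simp add: z)
    have "lamplighter (rep (h z)) z"
      by (rule marked_trans[OF marked_lamplighter conjunct1[OF rep] marked_sym[OF marked_lamplighter z]])
    then have "R (rep (h z)) z" using rep by (intro h(2)) auto
    then have "R (rep (h z) @ v) (z @ v)" by (rule marked_append[OF M]) (rule marked_refl[OF M])
    moreover have "R (w @ (winv v @ v)) (w @ [])"
      by (intro marked_append[OF M] marked_refl[OF M] marked_winv'[OF M])
    ultimately have "R (rep (h z) @ v) w"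
      using marked_trans[OF M, of "rep (h z) @ v" "z @ v" w] by (simp add: z_def)
    then have "mnorm R w \<le> length (rep (h z) @ v)" by (rule mnorm_le)
    moreover have "length (rep (h z)) \<le> C" unfolding C_def using h(1) by (intro Max_ge) auto
    ultimately show ?thesis using v(2) by simp
  qed
  then show ?thesis by blast
qed

lemma speed_fin_ext_le:
  assumes "fin_ext R"
  shows "\<exists>C>0. \<forall>n\<ge>1. speed R n \<le> C + 11 * (sqrt (2 * real n) * (1 + ln n))"
proof -
  obtain C where C: "\<And>w. mnorm R w \<le> C + 11 * (maxdisp w + 1)" using mnorm_fin_ext_le[OF assms] by blast
  have "speed R n \<le> (real C + 11) + 11 * (sqrt (2 * real n) * (1 + ln n))" if "n \<ge> 1" for n
  proof -
    have "speed R n \<le> avg n (\<lambda>w. (real C + 11) + 11 * real (maxdisp w))"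
      unfolding speed_def
    proof (rule avg_mono)
      fix w
      have "real (mnorm R w) \<le> real (C + 11 * (maxdisp w + 1))" using C by (simp only: of_nat_le_iff)
      then show "real (mnorm R w) \<le> (real C + 11) + 11 * real (maxdisp w)" by simp
    qed
    also have "\<dots> = (real C + 11) + 11 * avg n (\<lambda>w. real (maxdisp w))"
      by (simp only: avg_add avg_const avg_cmult)
    also have "\<dots> \<le> (real C + 11) + 11 * (sqrt (2 * real n) * (1 + ln n))"
      using avg_maxdisp_le[of n] that by simp
    finally show ?thesis .
  qed
  then show ?thesis by (intro exI[of _ "real C + 11"]) auto
qed

section \<open>Bounds for all quotients\<close>

lemma speed_ge:
  assumes "marked R" "\<And>w v. R w v \<Longrightarrow> disp w = disp v"
  shows "4 / 27 * sqrt n \<le> speed R n"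
proof -
  have "avg n (\<lambda>w. \<bar>real_of_int (disp w)\<bar>) \<le> speed R n"
    unfolding speed_def
  proof (rule avg_mono)
    fix w
    obtain v where v: "length v = mnorm R w" "R v w" using mnorm_witness[OF assms(1)] by blast
    then have "\<bar>disp w\<bar> \<le> int (mnorm R w)" using abs_disp_le[of v] assms(2)[of v w] by simp
    then show "\<bar>real_of_int (disp w)\<bar> \<le> real (mnorm R w)" by linarith
  qed
  then show ?thesis using avg_abs_disp[of n] by linarith
qed

text \<open>The same balance as in the upper bound: with \<open>r\<close> about
  \<open>n powr (1 / 3)\<close> both terms of the lamplighter estimate are of the same order. The
  constant 128 is 32 * 2^2, from \<open>r + 1 \<le> 2 * a\<close>.\<close>

lemma neg_ln_ret_ge:
  assumes "marked R" "\<And>w v. R w v \<Longrightarrow> lamplighter w v" "n \<ge> 1"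
  shows "real n powr (1 / 3) / 128 - ln 4 \<le> - ln (ret R n)"
proof -
  define a where "a = real n powr (1 / 3)"
  define r where "r = nat \<lfloor>a\<rfloor>"
  have a1: "a \<ge> 1" unfolding a_def using assms(3) by (simp add: ge_one_powr_ge_zero)
  have a3: "a ^ 3 = n" unfolding a_def using assms(3) by (simp add: powr_realpow[symmetric] powr_powr)
  have r: "real r + 1 \<le> 2 * a" "a - 1 \<le> real r" unfolding r_def using a1 by linarith+
  have "(1 - 1 / (32 * (real r + 1)\<^sup>2)) ^ n \<le> exp (- (a / 128))"
  proof -
    have "1 - 1 / (32 * (real r + 1)\<^sup>2) \<le> exp (- (1 / (32 * (real r + 1)\<^sup>2)))"
      using exp_ge_add_one_self[of "- (1 / (32 * (real r + 1)\<^sup>2))"] by simp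
    also have "\<dots> \<le> exp (- (1 / (32 * (2 * a)\<^sup>2)))"
      using r(1) a1 by (simp only: exp_le_cancel_iff neg_le_iff_le)
        (intro divide_left_mono mult_left_mono power_mono, auto)
    finally have "(1 - 1 / (32 * (real r + 1)\<^sup>2)) ^ n \<le> exp (- (1 / (32 * (2 * a)\<^sup>2))) ^ n"
    proof (rule power_mono)
      have "1 \<le> (real r + 1)\<^sup>2" by (simp add: one_le_power)
      then have "1 \<le> 32 * (real r + 1)\<^sup>2" by linarith
      then show "0 \<le> 1 - 1 / (32 * (real r + 1)\<^sup>2)" by (simp add: divide_le_eq)
    qed
    also have "\<dots> = exp (- (a ^ 3 / (128 * a\<^sup>2)))"
      by (simp add: exp_of_nat_mult[symmetric] a3 power_mult_distrib)
    also have "a ^ 3 / (128 * a\<^sup>2) = a / 128"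
      using a1 by (simp add: power2_eq_square power3_eq_cube)
    finally show ?thesis .
  qed
  moreover have "(3 / 4) ^ r \<le> 2 * exp (- (a / 128))"
  proof -
    have "(3 / 4 :: real) ^ r \<le> exp (- (1 / 4)) ^ r"
      using exp_ge_add_one_self[of "- (1 / 4)"] by (intro power_mono) auto
    also have "\<dots> = exp (- (real r / 4))" by (simp add: exp_of_nat_mult[symmetric])
    also have "\<dots> \<le> exp (1 / 4 - a / 128)" using r(2) a1 by simp
    also have "\<dots> = exp (1 / 4) * exp (- (a / 128))" by (simp add: exp_add[symmetric])
    also have "\<dots> \<le> 2 * exp (- (a / 128))"
      using exp_bound_half[of "1 / 4 :: real"] by (intro mult_right_mono) auto
    finally show ?thesis .
  qed
  ultimately have "ret R n \<le> 4 * exp (- (a / 128))"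
    using ret_lamplighter_le[of n r] ret_mono[of R lamplighter n] assms(2) by fastforce
  moreover have "ret R n > 0" using ret_ge[OF assms(1), of n] by (smt (verit) zero_less_power divide_pos_pos)
  ultimately have "ln (ret R n) \<le> ln (4 * exp (- (a / 128)))" by simp
  also have "\<dots> = ln 4 - a / 128" by (simp add: ln_mult)
  finally show ?thesis by (simp add: a_def)
qed

section \<open>Exponents\<close>

definition retexp :: "(word \<Rightarrow> word \<Rightarrow> bool) \<Rightarrow> nat \<Rightarrow> real" where
  "retexp R n = ln \<bar>ln (ret R n)\<bar> / ln (real n)"

definition speedexp :: "(word \<Rightarrow> word \<Rightarrow> bool) \<Rightarrow> nat \<Rightarrow> real" where
  "speedexp R n = ln (speed R n) / ln (real n)"

lemma ret_pos: "marked R \<Longrightarrow> 0 < ret R n"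
  by (rule less_le_trans[OF _ ret_ge]) auto

lemma abs_ln_ret: "marked R \<Longrightarrow> \<bar>ln (ret R n)\<bar> = - ln (ret R n)"
  using ret_le_1[of R n] ret_pos[of R n] by simp

lemma eventually_ratio_le:
  assumes "\<forall>\<^sub>F n in sequentially. 0 < f n \<and> f n \<le> g n"
    and "((\<lambda>n. ln (g n) / ln (real n)) \<longlongrightarrow> a) sequentially" "a < b"
  shows "\<forall>\<^sub>F n in sequentially. ln (f n) / ln (real n) \<le> b"
  using assms(1) order_tendstoD(2)[OF assms(2,3)] eventually_gt_at_top[of 1]
proof eventually_elim
  case (elim n)
  then have "ln (f n) / ln (real n) \<le> ln (g n) / ln (real n)"
    by (intro divide_right_mono) auto
  then show ?case using elim by linarith
qed

lemma eventually_ratio_ge: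
  assumes "\<forall>\<^sub>F n in sequentially. 0 < g n \<and> g n \<le> f n"
    and "((\<lambda>n. ln (g n) / ln (real n)) \<longlongrightarrow> a) sequentially" "b < a"
  shows "\<forall>\<^sub>F n in sequentially. b \<le> ln (f n) / ln (real n)"
  using assms(1) order_tendstoD(1)[OF assms(2,3)] eventually_gt_at_top[of 1]
proof eventually_elim
  case (elim n)
  then have "ln (g n) / ln (real n) \<le> ln (f n) / ln (real n)"
    by (intro divide_right_mono) auto
  then show ?case using elim by linarith
qed

lemma eventually_retexp_ge:
  assumes M: "marked R" and lamplighter: "\<And>w v. R w v \<Longrightarrow> lamplighter w v" and "e > 0"
  shows "\<forall>\<^sub>F n in sequentially. 1 / 3 - e \<le> retexp R n"
  unfolding retexp_def abs_ln_ret[OF M]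
proof (rule eventually_ratio_ge)
  have "\<forall>\<^sub>F n in sequentially. 0 < real n powr (1 / 3) / 128 - ln 4" by real_asymp
  then show "\<forall>\<^sub>F n in sequentially. 0 < real n powr (1 / 3) / 128 - ln 4 \<and>
      real n powr (1 / 3) / 128 - ln 4 \<le> - ln (ret R n)"
    using eventually_ge_at_top[of 1] by eventually_elim (use neg_ln_ret_ge[OF M lamplighter] in auto)
  show "(\<lambda>n. ln (real n powr (1 / 3) / 128 - ln 4) / ln (real n)) \<longlonglongrightarrow> 1 / 3" by real_asymp
qed (use assms in auto)

lemma eventually_neg_ln_ret_pos:
  assumes M: "marked R" and lamplighter: "\<And>w v. R w v \<Longrightarrow> lamplighter w v"
  shows "\<forall>\<^sub>F n in sequentially. 0 < - ln (ret R n)"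
proof -
  have "\<forall>\<^sub>F n in sequentially. 0 < real n powr (1 / 3) / 128 - ln 4" by real_asymp
  then show ?thesis
    using eventually_ge_at_top[of 1]
  proof eventually_elim
    case (elim n)
    then show ?case using neg_ln_ret_ge[OF M lamplighter, of n] by linarith
  qed
qed

lemma eventually_retexp_le:
  assumes M: "marked R" and lamplighter: "\<And>w v. R w v \<Longrightarrow> lamplighter w v" and "e > 0"
  shows "\<forall>\<^sub>F n in sequentially. retexp R n \<le> 1 + e"
  unfolding retexp_def abs_ln_ret[OF M]
proof (rule eventually_ratio_le)
  have pos: "\<forall>\<^sub>F n in sequentially. 0 < - ln (ret R n)"
    by (rule eventually_neg_ln_ret_pos[OF M]) (rule lamplighter)
  show "\<forall>\<^sub>F n in sequentially. 0 < - ln (ret R n) \<and> - ln (ret R n) \<le> real n * ln 48"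
    using pos
  proof eventually_elim
    case (elim n)
    have "ln ((1 / 48) ^ n) \<le> ln (ret R n)" using ret_ge[OF M, of n] ret_pos[OF M, of n] by simp
    then show ?case using elim by (simp add: ln_realpow ln_div)
  qed
  show "(\<lambda>n. ln (real n * ln 48) / ln (real n)) \<longlonglongrightarrow> 1" by real_asymp
qed (use assms in auto)

lemma speed_pos:
  assumes "marked R" "\<And>w v. R w v \<Longrightarrow> lamplighter w v" "n > 0"
  shows "0 < speed R n"
proof -
  have "0 < 4 / 27 * sqrt n" using assms(3) by simp
  also have "\<dots> \<le> speed R n" using assms(1,2) by (intro speed_ge) (auto simp: lamplighter_def)
  finally show ?thesis .
qed

lemma eventually_speedexp_ge:
  assumes M: "marked R" and lamplighter: "\<And>w v. R w v \<Longrightarrow> lamplighter w v" and "e > 0"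
  shows "\<forall>\<^sub>F n in sequentially. 1 / 2 - e \<le> speedexp R n"
  unfolding speedexp_def
proof (rule eventually_ratio_ge)
  have "4 / 27 * sqrt (real n) \<le> speed R n" for n
    using M lamplighter by (intro speed_ge) (auto simp: lamplighter_def)
  then show "\<forall>\<^sub>F n in sequentially. 0 < 4 / 27 * sqrt (real n) \<and> 4 / 27 * sqrt (real n) \<le> speed R n"
    using eventually_gt_at_top[of 0] by (auto elim: eventually_mono)
  show "(\<lambda>n. ln (4 / 27 * sqrt (real n)) / ln (real n)) \<longlonglongrightarrow> 1 / 2" by real_asymp
qed (use assms in auto)

lemma eventually_speedexp_le:
  assumes M: "marked R" and lamplighter: "\<And>w v. R w v \<Longrightarrow> lamplighter w v" and "e > 0"
  shows "\<forall>\<^sub>F n in sequentially. speedexp R n \<le> 1 + e"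
  unfolding speedexp_def
proof (rule eventually_ratio_le)
  show "\<forall>\<^sub>F n in sequentially. 0 < speed R n \<and> speed R n \<le> real n"
    using eventually_gt_at_top[of 0]
    by eventually_elim (use speed_pos[OF M lamplighter] speed_le[OF M] in auto)
  show "(\<lambda>n. ln (real n) / ln (real n)) \<longlonglongrightarrow> 1" by real_asymp
qed (use assms in auto)

lemma eventually_small:
  assumes F: "fin_ext R" and e: "e > 0"
  shows "\<forall>\<^sub>F n in sequentially. retexp R n \<le> 1 / 3 + e \<and> speedexp R n \<le> 1 / 2 + e"
proof (rule eventually_conj)
  have M: "marked R" and lamplighter: "\<And>w v. R w v \<Longrightarrow> lamplighter w v" using F by (auto simp: fin_ext_def)
  have pos: "\<forall>\<^sub>F n in sequentially. 0 < - ln (ret R n)"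
    by (rule eventually_neg_ln_ret_pos[OF M]) (rule lamplighter)
  obtain C where C: "C > 0" "\<And>n. n \<ge> 1 \<Longrightarrow> - ln (ret R n) \<le> C * real n powr (1 / 3)"
    using neg_ln_ret_fin_ext_le[OF F] by blast
  obtain K where K: "K > 0" "\<And>n. n \<ge> 1 \<Longrightarrow> speed R n \<le> K + 11 * (sqrt (2 * real n) * (1 + ln n))"
    using speed_fin_ext_le[OF F] by blast
  show "\<forall>\<^sub>F n in sequentially. retexp R n \<le> 1 / 3 + e"
    unfolding retexp_def abs_ln_ret[OF M]
  proof (rule eventually_ratio_le)
    show "\<forall>\<^sub>F n in sequentially. 0 < - ln (ret R n) \<and> - ln (ret R n) \<le> C * real n powr (1 / 3)"
      using pos eventually_ge_at_top[of 1]
      by eventually_elim (use C(2) in auto)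
    show "(\<lambda>n. ln (C * real n powr (1 / 3)) / ln (real n)) \<longlonglongrightarrow> 1 / 3"
      using C(1) by real_asymp
  qed (use e in auto)
  show "\<forall>\<^sub>F n in sequentially. speedexp R n \<le> 1 / 2 + e"
    unfolding speedexp_def
  proof (rule eventually_ratio_le)
    show "\<forall>\<^sub>F n in sequentially. 0 < speed R n \<and> speed R n \<le> K + 11 * (sqrt (2 * real n) * (1 + ln n))"
      using eventually_ge_at_top[of 1] by eventually_elim (use speed_pos[OF M lamplighter] K(2) in auto)
    show "(\<lambda>n. ln (K + 11 * (sqrt (2 * real n) * (1 + ln (real n)))) / ln (real n)) \<longlonglongrightarrow> 1 / 2"
      using K(1) by real_asymp
  qed (use e in auto)
qed

lemma card_words_le: "card {v :: word. length v \<le> j} \<le> 48 ^ (j + 1)"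
proof -
  have "card {v :: word. length v \<le> j} = (\<Sum>i\<le>j. 48 ^ i)"
    using card_lists_length_le[of "UNIV :: letter set" j] by (simp add: card_letter)
  also have "\<dots> \<le> 48 ^ (j + 1)" by (induction j) auto
  finally show ?thesis .
qed

text \<open>Union bound: there are at most \<open>48 ^ (j + 1)\<close> words of length at most
  \<open>j\<close>, and each represents the random element with probability at most
  \<open>q ^ n\<close>. Otherwise the norm is at least \<open>j + 1\<close>.\<close>

lemma speed_ge_of_decay:
  assumes M: "marked R" and q: "0 < q" and decay: "\<And>v. avg n (\<lambda>w. of_bool (R v w)) \<le> q ^ n"
  shows "(real j + 1) * (1 - 48 ^ (j + 1) * q ^ n) \<le> speed R n"
proof -
  let ?V = "{v :: word. length v \<le> j}"
  have "finite ?V" using finite_lists_length_le[of "UNIV :: letter set" j] by simp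
  have "(real j + 1) * (1 - 48 ^ (j + 1) * q ^ n) \<le>
      (real j + 1) * (1 - (\<Sum>v\<in>?V. avg n (\<lambda>w. of_bool (R v w))))"
  proof (intro mult_left_mono diff_left_mono)
    have "(\<Sum>v\<in>?V. avg n (\<lambda>w. of_bool (R v w))) \<le> real (card ?V) * q ^ n"
      using sum_mono[of ?V "\<lambda>v. avg n (\<lambda>w. of_bool (R v w))" "\<lambda>_. q ^ n"] decay by simp
    also have "\<dots> \<le> real (48 ^ (j + 1)) * q ^ n"
      using q card_words_le by (intro mult_right_mono) (simp_all only: of_nat_le_iff, simp)
    finally show "(\<Sum>v\<in>?V. avg n (\<lambda>w. of_bool (R v w))) \<le> 48 ^ (j + 1) * q ^ n" by simp
  qed simp
  also have "\<dots> = avg n (\<lambda>w. (real j + 1) * (1 - (\<Sum>v\<in>?V. of_bool (R v w))))"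
    by (simp only: avg_cmult avg_diff avg_const avg_sum)
  also have "\<dots> \<le> speed R n"
    unfolding speed_def
  proof (rule avg_mono)
    fix w
    have nonneg: "0 \<le> (\<Sum>v\<in>?V. of_bool (R v w) :: real)" by (intro sum_nonneg) simp
    show "(real j + 1) * (1 - (\<Sum>v\<in>?V. of_bool (R v w))) \<le> real (mnorm R w)"
    proof (cases "mnorm R w \<le> j")
      case True
      obtain v where v: "length v = mnorm R w" "R v w" using mnorm_witness[OF M] by blast
      have "of_bool (R v w) \<le> (\<Sum>v\<in>?V. of_bool (R v w) :: real)"
        by (rule member_le_sum) (use v True \<open>finite ?V\<close> in auto)
      then have "(real j + 1) * (1 - (\<Sum>v\<in>?V. of_bool (R v w))) \<le> 0"
        using v(2) by (intro mult_nonneg_nonpos) auto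
      then show ?thesis by simp
    next
      case False
      have "(real j + 1) * (1 - (\<Sum>v\<in>?V. of_bool (R v w))) \<le> (real j + 1) * 1"
        using nonneg by (intro mult_left_mono) auto
      also have "\<dots> \<le> real (mnorm R w)" using False by simp
      finally show ?thesis .
    qed
  qed
  finally show ?thesis .
qed

lemma eventually_large:
  assumes M: "marked R" and lamplighter: "\<And>w v. R w v \<Longrightarrow> lamplighter w v" and offset_lamps: "\<And>w v. R w v \<Longrightarrow> offset_lamps k w v"
    and k: "k > 0" and e: "e > 0"
  shows "\<forall>\<^sub>F n in sequentially. 1 - e \<le> retexp R n \<and> 1 - e \<le> speedexp R n"
proof (rule eventually_conj)
  obtain q where q: "0 < q" "q < 1" "\<And>n v. avg n (\<lambda>w. of_bool (R v w)) \<le> q ^ n"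
    using offset_lamps_decay[OF k] offset_lamps by blast
  define b where "b = - ln q"
  have b: "b > 0" using q by (simp add: b_def)
  have qn: "q ^ n = exp (- (b * real n))" for n
    using q(1) by (simp add: b_def mult.commute[of "ln q"] exp_of_nat_mult)
  have "ret R n \<le> q ^ n" for n
  proof -
    have "R w [] = R [] w" for w using marked_sym[OF M] by blast
    then show ?thesis using q(3)[of n "[]"] by (simp add: ret_def)
  qed
  then have "ln (ret R n) \<le> ln (exp (- (b * real n)))" for n
    unfolding qn[symmetric] using ret_pos[OF M, of n] q(1) by (subst ln_le_cancel_iff) auto
  then have lower: "b * real n \<le> - ln (ret R n)" for n by (simp add: le_minus_iff)
  show "\<forall>\<^sub>F n in sequentially. 1 - e \<le> retexp R n"
    unfolding retexp_def abs_ln_ret[OF M]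
  proof (rule eventually_ratio_ge)
    show "\<forall>\<^sub>F n in sequentially. 0 < b * real n \<and> b * real n \<le> - ln (ret R n)"
      using eventually_gt_at_top[of 0] by eventually_elim (use lower b in auto)
    show "(\<lambda>n. ln (b * real n) / ln (real n)) \<longlonglongrightarrow> 1" using b by real_asymp
  qed (use e in auto)
  \<comment> \<open>Chosen so that \<open>48 powr (c * n) = exp (b / 2 * n)\<close>: the ball of
    radius \<open>c * n\<close> then grows at half the rate at which probabilities decay.\<close>
  define c where "c = b / (2 * ln 48)"
  have c: "c > 0" using b by (simp add: c_def)
  let ?g = "\<lambda>n. c * real n * (1 - 48 * exp (- (b / 2 * real n)))"
  have g: "?g n \<le> speed R n" if pos: "0 < ?g n" for n
  proof -
    define j where "j = nat \<lfloor>c * real n\<rfloor>"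
    have cn: "0 \<le> c * real n" using c by simp
    then have j: "c * real n \<le> real j + 1" "real j \<le> c * real n"
      unfolding j_def using \<open>0 \<le> c * real n\<close> by linarith+
    have "(48 :: real) ^ (j + 1) = 48 * exp (real j * ln 48)"
      by (simp add: exp_of_nat_mult)
    also have "\<dots> \<le> 48 * exp (c * real n * ln 48)" using j(2) by simp
    also have "c * real n * ln 48 = b / 2 * real n" by (simp add: c_def)
    finally have "48 ^ (j + 1) * q ^ n \<le> 48 * exp (b / 2 * real n) * q ^ n"
      using q(1) by (intro mult_right_mono) auto
    also have "\<dots> = 48 * exp (- (b / 2 * real n))"
      by (simp add: qn exp_add[symmetric] field_simps)
    finally have le: "1 - 48 * exp (- (b / 2 * real n)) \<le> 1 - 48 ^ (j + 1) * q ^ n" by simp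
    have "0 < 1 - 48 * exp (- (b / 2 * real n))"
      using pos cn mult_nonneg_nonpos[of "c * real n" "1 - 48 * exp (- (b / 2 * real n))"]
      by linarith
    then have "?g n \<le> (real j + 1) * (1 - 48 ^ (j + 1) * q ^ n)"
      using j(1) le by (intro mult_mono) auto
    also have "\<dots> \<le> speed R n" by (rule speed_ge_of_decay[OF M q(1,3)])
    finally show ?thesis .
  qed
  show "\<forall>\<^sub>F n in sequentially. 1 - e \<le> speedexp R n"
    unfolding speedexp_def
  proof (rule eventually_ratio_ge)
    have "\<forall>\<^sub>F n in sequentially. 0 < ?g n" using b c by real_asymp
    then show "\<forall>\<^sub>F n in sequentially. 0 < ?g n \<and> ?g n \<le> speed R n"
      by eventually_elim (use g in auto)
    show "(\<lambda>n. ln (?g n) / ln (real n)) \<longlonglongrightarrow> 1" using b c by real_asymp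
  qed (use e in auto)
qed

section \<open>The oscillating group\<close>

text \<open>Both kinds of behaviour occur at some time between \<open>m\<close> and \<open>m' / 2\<close>; by \<open>agree\<close>, this only
  depends on words of total length at most \<open>m'\<close>.\<close>

definition window :: "(word \<Rightarrow> word \<Rightarrow> bool) \<Rightarrow> nat \<Rightarrow> nat \<Rightarrow> bool" where
  "window R m m' \<longleftrightarrow>
    (\<exists>n\<ge>m. 2 * n \<le> m' \<and> retexp R n \<le> 1 / 3 + 1 / (real m + 1) \<and> speedexp R n \<le> 1 / 2 + 1 / (real m + 1)) \<and>
    (\<exists>n\<ge>m. 2 * n \<le> m' \<and> 1 - 1 / (real m + 1) \<le> retexp R n \<and> 1 - 1 / (real m + 1) \<le> speedexp R n)"

lemma agree_exp:
  assumes "agree m R R'" "marked R" "marked R'" "2 * n \<le> m"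
  shows "retexp R n = retexp R' n" "speedexp R n = speedexp R' n"
  using agree_ret[OF assms(1), of n] agree_speed[OF assms] assms(4) by (auto simp: retexp_def speedexp_def)

lemma agree_window:
  assumes "agree m' R R'" "marked R" "marked R'" "window R m m'"
  shows "window R' m m'"
  using assms(4) agree_exp[OF assms(1-3)] unfolding window_def by metis

text \<open>The order of choices matters: \<open>k\<close> depends on \<open>m\<close>, the time
  \<open>n1\<close> on the large group \<open>V\<close>, the truncation on \<open>n1\<close>, and
  the time \<open>n2\<close> on the truncated group, which is small again. \<open>V\<close> only
  serves to find \<open>n1\<close>.\<close>

lemma fin_ext_extend:
  assumes F: "fin_ext R"
  shows "\<exists>R' m'. fin_ext R' \<and> (\<forall>w v. R' w v \<longrightarrow> R w v) \<and> agree m R' R \<and> m < m' \<and> window R' m m'"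
proof -
  have M: "marked R" and lamplighter: "\<And>w v. R w v \<Longrightarrow> lamplighter w v" using F by (auto simp: fin_ext_def)
  \<comment> \<open>Exceeds \<open>2 * m\<close>, so that words of length at most \<open>m\<close>
    which are trivial in the lamplighter group are also trivial for the offset lamps.\<close>
  define k where "k = 2 * int m + 1"
  define V where "V w v \<longleftrightarrow> R w v \<and> offset_lamps k w v" for w v
  have MV: "marked V" unfolding V_def by (rule marked_conj[OF M]) (simp add: offset_lamps_def marked_Rel)
  have e: "1 / (real m + 1) > 0" by simp
  have "\<forall>\<^sub>F n in sequentially. 1 - 1 / (real m + 1) \<le> retexp V n \<and> 1 - 1 / (real m + 1) \<le> speedexp V n"
    by (rule eventually_large[OF MV _ _ _ e, of k]) (auto simp: V_def k_def lamplighter)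
  then obtain n1 where n1: "n1 \<ge> m" "1 - 1 / (real m + 1) \<le> retexp V n1" "1 - 1 / (real m + 1) \<le> speedexp V n1"
    unfolding eventually_sequentially by (meson nle_le)
  define r where "r = 2 * n1"
  \<comment> \<open>The period exceeds what words of length \<open>r\<close> can see, and lists of
    length \<open>2 * r\<close> leave room for two toggles per letter.\<close>
  define R' where "R' w v \<longleftrightarrow> R w v \<and> periodic_lamps k (2 * k + 2 * int r + 1) (2 * r) w v" for w v
  have F': "fin_ext R'" unfolding R'_def by (rule fin_ext_conj_periodic_lamps[OF F]) (simp add: k_def)
  then have M': "marked R'" by (simp add: fin_ext_def)
  have agV: "agree r R' V"
  proof (rule agreeI[OF M' MV])
    fix w :: word assume "length w \<le> r"
    then show "R' w [] \<longleftrightarrow> V w []"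
      unfolding R'_def V_def using periodic_lamps_iff_offset_lamps[of k w "2 * k + 2 * int r + 1" "2 * r"] by (auto simp: k_def)
  qed
  have agR: "agree m V R"
  proof (rule agreeI[OF MV M])
    fix w :: word assume "length w \<le> m"
    then show "V w [] \<longleftrightarrow> R w []"
      unfolding V_def using lamplighter_imp_offset_lamps[of w k] lamplighter[of w "[]"] by (auto simp: k_def)
  qed
  have ag: "agree m R' R"
    using agree_mono[OF agV, of m] agR n1(1) unfolding agree_def r_def by auto
  have "\<forall>\<^sub>F n in sequentially. retexp R' n \<le> 1 / 3 + 1 / (real m + 1) \<and> speedexp R' n \<le> 1 / 2 + 1 / (real m + 1)"
    by (rule eventually_small[OF F' e])
  then obtain n2 where n2: "n2 \<ge> m" "retexp R' n2 \<le> 1 / 3 + 1 / (real m + 1)" "speedexp R' n2 \<le> 1 / 2 + 1 / (real m + 1)"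
    unfolding eventually_sequentially by (meson nle_le)
  define m' where "m' = 2 * n1 + 2 * n2 + m + 1"
  have "window R' m m'"
    unfolding window_def
  proof (intro conjI exI)
    show "1 - 1 / (real m + 1) \<le> retexp R' n1" "1 - 1 / (real m + 1) \<le> speedexp R' n1"
      using n1 agree_exp[OF agV M' MV, of n1] by (simp_all add: r_def)
  qed (use n1 n2 in \<open>auto simp: m'_def\<close>)
  moreover have "m < m'" by (simp add: m'_def)
  ultimately show ?thesis using F' ag unfolding R'_def by blast
qed

text \<open>Later stages agree with stage \<open>s\<close> on words of total length
  \<open>m s\<close>, so the intersection does too and keeps every window. The requirement
  \<open>s \<le> snd (f s)\<close> makes the errors \<open>1 / (m s + 1)\<close> tend to 0.\<close>

lemma exists_oscillating:
  "\<exists>R. marked R \<and> (\<forall>w v. R w v \<longrightarrow> lamplighter w v) \<and>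
    (\<forall>e>0. \<forall>N. \<exists>n\<ge>N. retexp R n \<le> 1 / 3 + e \<and> speedexp R n \<le> 1 / 2 + e) \<and>
    (\<forall>e>0. \<forall>N. \<exists>n\<ge>N. 1 - e \<le> retexp R n \<and> 1 - e \<le> speedexp R n)"
proof -
  let ?Q = "\<lambda>p p'. (\<forall>w v. fst p' w v \<longrightarrow> fst p w v) \<and> agree (snd p) (fst p') (fst p) \<and>
    snd p < snd p' \<and> window (fst p') (snd p) (snd p')"
  have "\<exists>f. \<forall>s. (fin_ext (fst (f s)) \<and> s \<le> snd (f s)) \<and> ?Q (f s) (f (Suc s))"
  proof (rule dependent_nat_choice)
    show "\<exists>p :: (word \<Rightarrow> word \<Rightarrow> bool) \<times> nat. fin_ext (fst p) \<and> 0 \<le> snd p" using fin_ext_lamplighter by (intro exI[of _ "(lamplighter, 0)"]) simp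
    fix p :: "(word \<Rightarrow> word \<Rightarrow> bool) \<times> nat" and s
    assume p: "fin_ext (fst p) \<and> s \<le> snd p"
    obtain R' m' where "fin_ext R'" "\<forall>w v. R' w v \<longrightarrow> fst p w v" "agree (snd p) R' (fst p)"
      "snd p < m'" "window R' (snd p) m'"
      using fin_ext_extend[of "fst p" "snd p"] p by blast
    then show "\<exists>p'. (fin_ext (fst p') \<and> Suc s \<le> snd p') \<and> ?Q p p'"
      using p by (intro exI[of _ "(R', m')"]) auto
  qed
  then obtain f where f: "\<And>s. fin_ext (fst (f s))" "\<And>s. s \<le> snd (f s)" "\<And>s. ?Q (f s) (f (Suc s))"
    by blast
  define Rs where "Rs s = fst (f s)" for s
  define m where "m s = snd (f s)" for s
  have F: "fin_ext (Rs s)" and ms: "s \<le> m s" and dec: "Rs (Suc s) w v \<Longrightarrow> Rs s w v"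
    and ag: "agree (m s) (Rs (Suc s)) (Rs s)" and inc: "m s < m (Suc s)"
    and win: "window (Rs (Suc s)) (m s) (m (Suc s))" for s w v
    using f[of s] unfolding Rs_def m_def by blast+
  have Ms: "marked (Rs s)" for s using F[of s] by (simp add: fin_ext_def)
  define R where "R w v \<longleftrightarrow> (\<forall>s. Rs s w v)" for w v
  have M: "marked R" unfolding R_def by (rule marked_all) (rule Ms)
  have lamplighter: "R w v \<Longrightarrow> lamplighter w v" for w v using F[of 0] unfolding R_def fin_ext_def by blast
  have dec': "Rs t w v" if "Rs (t + d) w v" for t d w v
    using that by (induction d) (auto dest: dec)
  have inc': "m s \<le> m (s + d)" for s d
  proof (induction d)
    case (Suc d)
    then show ?case using inc[of "s + d"] by simp
  qed simp
  have ag': "agree (m s) (Rs (s + d)) (Rs s)" for s d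
  proof (induction d)
    case (Suc d)
    have "agree (m s) (Rs (Suc (s + d))) (Rs (s + d))" using agree_mono[OF ag inc'] .
    then show ?case using Suc by (simp add: agree_def)
  qed (simp add: agree_def)
  have agR: "agree (m s) (Rs s) R" for s
    unfolding agree_def
  proof (intro allI impI iffI)
    fix w v assume l: "length w + length v \<le> m s" and R: "Rs s w v"
    have "Rs t w v" for t
    proof (cases "s \<le> t")
      case True
      then show ?thesis using ag'[of s "t - s"] l R by (simp add: agree_def)
    next
      case False
      then show ?thesis using dec'[of t "s - t"] R by simp
    qed
    then show "R w v" by (simp add: R_def)
  qed (simp add: R_def)
  have winR: "window R (m s) (m (Suc s))" for s
    using agree_window[OF agR Ms M win] .
  have large_m: "\<exists>s. m s \<ge> N \<and> 1 / (real (m s) + 1) \<le> e" if e0: "e > 0" for e :: real and N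
  proof -
    obtain s0 where "inverse (real (Suc s0)) < e" using reals_Archimedean[OF e0] by blast
    then have s0: "1 / (real s0 + 1) < e" by (simp add: inverse_eq_divide add.commute)
    have "1 / (real (m (N + s0)) + 1) \<le> 1 / (real s0 + 1)"
      using ms[of "N + s0"] by (intro divide_left_mono) auto
    then show ?thesis using s0 ms[of "N + s0"] by (intro exI[of _ "N + s0"]) auto
  qed
  have "\<exists>n\<ge>N. retexp R n \<le> 1 / 3 + e \<and> speedexp R n \<le> 1 / 2 + e"
    "\<exists>n\<ge>N. 1 - e \<le> retexp R n \<and> 1 - e \<le> speedexp R n" if e: "e > 0" for e N
  proof -
    obtain s where s: "m s \<ge> N" "1 / (real (m s) + 1) \<le> e" using large_m[OF e] by blast
    obtain n where "n \<ge> m s" "retexp R n \<le> 1 / 3 + 1 / (real (m s) + 1)"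
      "speedexp R n \<le> 1 / 2 + 1 / (real (m s) + 1)" using winR[of s] unfolding window_def by blast
    then show "\<exists>n\<ge>N. retexp R n \<le> 1 / 3 + e \<and> speedexp R n \<le> 1 / 2 + e"
      using s by (intro exI[of _ n]) linarith
    obtain n' where "n' \<ge> m s" "1 - 1 / (real (m s) + 1) \<le> retexp R n'"
      "1 - 1 / (real (m s) + 1) \<le> speedexp R n'" using winR[of s] unfolding window_def by blast
    then show "\<exists>n\<ge>N. 1 - e \<le> retexp R n \<and> 1 - e \<le> speedexp R n"
      using s by (intro exI[of _ n']) linarith
  qed
  then show ?thesis using M lamplighter by blast
qed

section \<open>Transport to a group on the natural numbers\<close>

lemma liminf_eqI:
  fixes f :: "nat \<Rightarrow> real"
  assumes ge: "\<And>e. e > 0 \<Longrightarrow> \<forall>\<^sub>F n in sequentially. a - e \<le> f n"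
    and le: "\<And>e N. e > 0 \<Longrightarrow> \<exists>n\<ge>N. f n \<le> a + e"
  shows "liminf (\<lambda>n. ereal (f n)) = ereal a"
proof (rule antisym)
  show "ereal a \<le> liminf (\<lambda>n. ereal (f n))"
    unfolding le_Liminf_iff
  proof (intro allI impI)
    fix y assume "y < ereal a"
    then obtain b where b: "y < ereal b" "b < a" using ereal_dense2 by force
    show "\<forall>\<^sub>F n in sequentially. y < ereal (f n)"
      using ge[of "a - b"] b
      by (auto elim!: eventually_mono intro: less_le_trans)
  qed
  show "liminf (\<lambda>n. ereal (f n)) \<le> ereal a"
  proof (rule ccontr)
    assume "\<not> liminf (\<lambda>n. ereal (f n)) \<le> ereal a"
    then have "ereal a < liminf (\<lambda>n. ereal (f n))" by (simp only: not_le)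
    then obtain b where b: "ereal a < ereal b" "ereal b < liminf (\<lambda>n. ereal (f n))"
      using ereal_dense2 by blast
    have "\<forall>\<^sub>F n in sequentially. ereal b < ereal (f n)" by (rule less_LiminfD[OF b(2)])
    then obtain N where N: "\<And>n. n \<ge> N \<Longrightarrow> b < f n" by (auto simp: eventually_sequentially)
    obtain n where "n \<ge> N" "f n \<le> a + (b - a)" using le[of "b - a" N] b(1) by auto
    then show False using N[of n] by simp
  qed
qed

lemma limsup_eqI:
  fixes f :: "nat \<Rightarrow> real"
  assumes "\<And>e. e > 0 \<Longrightarrow> \<forall>\<^sub>F n in sequentially. f n \<le> a + e"
    and "\<And>e N. e > 0 \<Longrightarrow> \<exists>n\<ge>N. a - e \<le> f n"
  shows "limsup (\<lambda>n. ereal (f n)) = ereal a"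
proof -
  have "liminf (\<lambda>n. ereal (- f n)) = ereal (- a)"
  proof (rule liminf_eqI)
    fix e :: real assume e: "e > 0"
    show "\<forall>\<^sub>F n in sequentially. - a - e \<le> - f n"
      using assms(1)[OF e] by (rule eventually_mono) simp
    show "\<exists>n\<ge>N. - f n \<le> - a + e" for N
      using assms(2)[OF e, of N] by force
  qed
  moreover have "liminf (\<lambda>n. - ereal (f n)) = - limsup (\<lambda>n. ereal (f n))"
    by (rule ereal_Liminf_uminus)
  ultimately have "- limsup (\<lambda>n. ereal (f n)) = - ereal a" by simp
  then show ?thesis by (simp only: ereal_uminus_eq_iff)
qed

text \<open>Word norms for different generating sets are comparable, so they have the same exponents.\<close>

lemma eventually_ln_comparable:
  assumes "C > 0" and fg: "\<And>n. n > 0 \<Longrightarrow> 0 < f n \<and> 0 < g n \<and> f n \<le> C * g n"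
    and e: "e > 0"
  shows "\<forall>\<^sub>F n in sequentially. ln (f n) / ln (real n) \<le> ln (g n) / ln (real n) + e"
proof -
  have "((\<lambda>n. ln C / ln (real n)) \<longlongrightarrow> 0) sequentially" by real_asymp
  from order_tendstoD(2)[OF this e] show ?thesis
    using eventually_gt_at_top[of 1]
  proof eventually_elim
    case (elim n)
    then have n: "0 < f n" "0 < g n" "f n \<le> C * g n" using fg[of n] by auto
    then have "ln (f n) \<le> ln (C * g n)" using assms(1) by (subst ln_le_cancel_iff) auto
    also have "\<dots> = ln C + ln (g n)" using n assms(1) by (simp add: ln_mult)
    finally have "ln (f n) / ln (real n) \<le> (ln C + ln (g n)) / ln (real n)"
      using elim by (intro divide_right_mono) auto
    then show ?case using elim by (simp add: add_divide_distrib)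
  qed
qed

section \<open>The random word\<close>

text \<open>Letters are appended on the right exactly as \<open>rw_law\<close> multiplies, so the
  law of the walk is the image of this law under \<open>elt\<close>.\<close>

primrec wpmf :: "nat \<Rightarrow> word pmf" where
  "wpmf 0 = return_pmf []"
| "wpmf (Suc n) = bind_pmf (wpmf n) (\<lambda>w. map_pmf (\<lambda>l. w @ [l]) (pmf_of_set UNIV))"

lemma finite_set_wpmf: "finite (set_pmf (wpmf n))"
  by (induction n) auto

lemma expectation_wpmf: "measure_pmf.expectation (wpmf n) f = avg n f"
proof (induction n arbitrary: f)
  case (Suc n)
  have "measure_pmf.expectation (wpmf (Suc n)) f = (\<Sum>w\<in>set_pmf (wpmf n). pmf (wpmf n) w *\<^sub>R
      measure_pmf.expectation (map_pmf (\<lambda>l. w @ [l]) (pmf_of_set UNIV)) f)"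
    unfolding wpmf.simps by (rule pmf_expectation_bind[OF finite_set_wpmf]) auto
  also have "\<dots> = (\<Sum>w\<in>set_pmf (wpmf n). pmf (wpmf n) w *\<^sub>R ((\<Sum>l\<in>UNIV. f (w @ [l])) / 48))"
    by (simp add: integral_pmf_of_set card_option)
  also have "\<dots> = measure_pmf.expectation (wpmf n) (\<lambda>w. (\<Sum>l\<in>UNIV. f (w @ [l])) / 48)"
    by (rule integral_measure_pmf[OF finite_set_wpmf, symmetric]) auto
  also have "\<dots> = avg (Suc n) f" unfolding Suc avg_Suc ..
  finally show ?case .
qed simp

section \<open>The group of a congruence\<close>

context
  fixes R :: "word \<Rightarrow> word \<Rightarrow> bool"
  assumes M: "marked R"
begin

text \<open>A class is encoded by the number of a chosen representative; equivalent words define the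
  same predicate and hence get the same choice.\<close>

definition elt :: "word \<Rightarrow> nat" where
  "elt w = to_nat (SOME v. R v w)"

definition grp :: "nat monoid" where
  "grp = \<lparr>carrier = range elt, monoid.mult = (\<lambda>a b. elt (from_nat a @ from_nat b)), one = elt []\<rparr>"

definition law :: "nat pmf" where
  "law = map_pmf (\<lambda>l. elt [l]) (pmf_of_set UNIV)"

lemma from_nat_elt: "R (from_nat (elt w)) w"
  using someI[of "\<lambda>v. R v w" w] marked_refl[OF M] by (simp add: elt_def)

lemma elt_eq_iff: "elt w = elt v \<longleftrightarrow> R w v"
proof
  assume "elt w = elt v"
  then have "R (from_nat (elt w)) v" using from_nat_elt[of v] by simp
  then show "R w v" by (rule marked_trans[OF M marked_sym[OF M from_nat_elt]])
next
  assume wv: "R w v"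
  have "R u w \<longleftrightarrow> R u v" for u
    using marked_trans[OF M _ wv, of u] marked_trans[OF M _ marked_sym[OF M wv], of u] by blast
  then show "elt w = elt v" by (simp add: elt_def)
qed

lemma elt_mult: "elt w \<otimes>\<^bsub>grp\<^esub> elt v = elt (w @ v)"
  by (simp add: grp_def elt_eq_iff marked_append[OF M] from_nat_elt)

lemma carrier_grp: "carrier grp = range elt"
  by (simp add: grp_def)

lemma one_grp: "\<one>\<^bsub>grp\<^esub> = elt []"
  by (simp add: grp_def)

lemma group_grp: "group grp"
proof (rule groupI)
  fix x assume "x \<in> carrier grp"
  then obtain w where "x = elt w" by (auto simp: carrier_grp)
  then show "\<exists>y\<in>carrier grp. y \<otimes>\<^bsub>grp\<^esub> x = \<one>\<^bsub>grp\<^esub>"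
    by (intro bexI[of _ "elt (winv w)"])
      (auto simp: carrier_grp one_grp elt_mult elt_eq_iff marked_winv'[OF M])
qed (auto simp: carrier_grp one_grp elt_mult)

lemma inv_elt: "inv\<^bsub>grp\<^esub> (elt w) = elt (winv w)"
  by (rule group.inv_equality[OF group_grp])
    (auto simp: carrier_grp one_grp elt_mult elt_eq_iff marked_winv'[OF M])

lemma set_law: "set_pmf law = range (\<lambda>l. elt [l])"
  by (simp add: law_def)

text \<open>The map \<open>linv\<close> permutes the letters and represents inversion, so it
  preserves the uniform law.\<close>

lemma law_symmetric:
  assumes "x \<in> carrier grp"
  shows "pmf law (inv\<^bsub>grp\<^esub> x) = pmf law x"
proof -
  obtain w where x: "x = elt w" using assms by (auto simp: carrier_grp)
  have inj: "elt [linv l] = inv\<^bsub>grp\<^esub> x \<longleftrightarrow> elt [l] = x" for l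
  proof -
    have "elt [linv l] = inv\<^bsub>grp\<^esub> (elt [l])" by (simp add: inv_elt winv_Cons)
    moreover have "elt [l] \<in> carrier grp" by (simp add: carrier_grp)
    ultimately show ?thesis
      using group.inv_inv[OF group_grp] assms by metis
  qed
  have "map_pmf linv (pmf_of_set UNIV) = pmf_of_set UNIV"
    by (rule map_pmf_of_set_bij_betw[OF bij_linv]) auto
  then have "law = map_pmf (\<lambda>l. elt [linv l]) (pmf_of_set UNIV)"
    unfolding law_def by (metis (no_types, lifting) map_pmf_comp map_pmf_cong)
  then have "pmf law (inv\<^bsub>grp\<^esub> x) =
      measure (pmf_of_set UNIV) ((\<lambda>l. elt [linv l]) -` {inv\<^bsub>grp\<^esub> x})"
    by (simp add: pmf_map)
  also have "(\<lambda>l. elt [linv l]) -` {inv\<^bsub>grp\<^esub> x} = (\<lambda>l. elt [l]) -` {x}"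
    using inj by auto
  also have "measure (pmf_of_set UNIV) ((\<lambda>l. elt [l]) -` {x}) = pmf law x"
    by (simp add: law_def pmf_map)
  finally show ?thesis .
qed

lemma generate_law: "generate grp (set_pmf law) = carrier grp"
proof
  show "generate grp (set_pmf law) \<subseteq> carrier grp"
    by (rule group.generate_incl[OF group_grp]) (auto simp: set_law carrier_grp)
  have "elt w \<in> generate grp (set_pmf law)" for w
  proof (induction w)
    case Nil
    show ?case using generate.one[of grp "set_pmf law"] by (simp add: one_grp)
  next
    case (Cons l w)
    have "elt [l] \<in> generate grp (set_pmf law)" by (rule generate.incl) (simp add: set_law)
    from generate.eng[OF this Cons] show ?case by (simp add: elt_mult)
  qed
  then show "carrier grp \<subseteq> generate grp (set_pmf law)" by (auto simp: carrier_grp)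
qed

lemma rw_law_grp: "rw_law grp law n = map_pmf elt (wpmf n)"
proof (induction n)
  case (Suc n)
  show ?case
    unfolding rw_law.simps wpmf.simps Suc
    by (simp add: law_def map_bind_pmf bind_map_pmf map_pmf_comp elt_mult)
qed (simp add: one_grp)

lemma pmf_rw_law_one: "pmf (rw_law grp law n) \<one>\<^bsub>grp\<^esub> = ret R n"
proof -
  have "pmf (rw_law grp law n) \<one>\<^bsub>grp\<^esub> =
      measure_pmf.expectation (wpmf n) (indicator (elt -` {elt []}))"
    by (simp add: rw_law_grp pmf_map one_grp)
  also have "\<dots> = ret R n"
    unfolding expectation_wpmf ret_def
    by (intro avg_cong) (simp add: elt_eq_iff indicator_def)
  finally show ?thesis .
qed

section \<open>Word norms for arbitrary finite generating sets\<close>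

context
  fixes T :: "nat set"
  assumes T: "finite T" "T \<subseteq> carrier grp" "generate grp T = carrier grp"
begin

abbreviation "T' \<equiv> T \<union> m_inv grp ` T"

lemma T'_carrier: "T' \<subseteq> carrier grp"
  using T(2) group.inv_closed[OF group_grp] by blast

lemma foldr_closed: "set ts \<subseteq> T' \<Longrightarrow> foldr (mult grp) ts \<one>\<^bsub>grp\<^esub> \<in> carrier grp"
  using T'_carrier by (induction ts) (auto simp: one_grp carrier_grp elt_mult)

lemma foldr_append:
  assumes "set ts \<subseteq> T'" "set us \<subseteq> T'"
  shows "foldr (mult grp) (ts @ us) \<one>\<^bsub>grp\<^esub> =
    foldr (mult grp) ts \<one>\<^bsub>grp\<^esub> \<otimes>\<^bsub>grp\<^esub> foldr (mult grp) us \<one>\<^bsub>grp\<^esub>"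
  using assms(1)
proof (induction ts)
  case Nil
  obtain u where "foldr (mult grp) us \<one>\<^bsub>grp\<^esub> = elt u"
    using foldr_closed[OF assms(2)] by (auto simp: carrier_grp)
  then show ?case by (simp add: one_grp elt_mult)
next
  case (Cons t ts)
  have "t \<in> carrier grp" "foldr (mult grp) ts \<one>\<^bsub>grp\<^esub> \<in> carrier grp"
    using T'_carrier foldr_closed[of ts] Cons.prems by auto
  then show ?case
    using Cons foldr_closed[OF assms(2)]
    by (simp add: monoid.m_assoc[OF group.is_monoid[OF group_grp]])
qed

lemma exists_T_word:
  assumes "x \<in> carrier grp"
  shows "\<exists>ts. set ts \<subseteq> T' \<and> foldr (mult grp) ts \<one>\<^bsub>grp\<^esub> = x"
proof -
  have "x \<in> generate grp T" using assms T(3) by simp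
  then show ?thesis
  proof induction
    case one
    show ?case by (intro exI[of _ "[]"]) simp
  next
    case (incl h)
    then show ?case using T(2) monoid.r_one[OF group.is_monoid[OF group_grp]]
      by (intro exI[of _ "[h]"]) auto
  next
    case (inv h)
    then show ?case using T'_carrier monoid.r_one[OF group.is_monoid[OF group_grp]]
      by (intro exI[of _ "[inv\<^bsub>grp\<^esub> h]"]) auto
  next
    case (eng h1 h2)
    then obtain ts us where "set ts \<subseteq> T'" "foldr (mult grp) ts \<one>\<^bsub>grp\<^esub> = h1"
      "set us \<subseteq> T'" "foldr (mult grp) us \<one>\<^bsub>grp\<^esub> = h2" by blast
    then show ?case using foldr_append[of ts us] by (intro exI[of _ "ts @ us"]) auto
  qed
qed

lemma word_norm_witness:
  assumes "x \<in> carrier grp"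
  shows "\<exists>ts. length ts = word_norm grp T x \<and> set ts \<subseteq> T' \<and> foldr (mult grp) ts \<one>\<^bsub>grp\<^esub> = x"
  unfolding word_norm_def by (rule LeastI_ex) (use exists_T_word[OF assms] in blast)

lemma word_norm_le:
  "set ts \<subseteq> T' \<Longrightarrow> word_norm grp T (foldr (mult grp) ts \<one>\<^bsub>grp\<^esub>) \<le> length ts"
  unfolding word_norm_def by (rule Least_le) blast

text \<open>Each element of \<open>T'\<close> is spelled by its chosen word, of length at most
  \<open>C\<close>. Inserting 0 covers empty \<open>T\<close>, and \<open>Suc\<close> makes the
  constant positive.\<close>

lemma mnorm_le_word_norm: "\<exists>C>0. \<forall>w. mnorm R w \<le> C * word_norm grp T (elt w)"
proof -
  define C where "C = Suc (Max (insert 0 ((\<lambda>t. length (from_nat t :: word)) ` T')))"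
  have C: "length (from_nat t :: word) \<le> C" if "t \<in> T'" for t
    unfolding C_def using that T(1) by (intro le_SucI Max_ge) auto
  have key: "elt (concat (map from_nat ts)) = foldr (mult grp) ts \<one>\<^bsub>grp\<^esub>
      \<and> length (concat (map from_nat ts) :: word) \<le> C * length ts" if "set ts \<subseteq> T'" for ts
    using that
  proof (induction ts)
    case (Cons t ts)
    have "t \<in> carrier grp" using T'_carrier Cons.prems by auto
    then obtain w where "t = elt w" by (auto simp: carrier_grp)
    then have "elt (from_nat t) = t" using from_nat_elt[of w] elt_eq_iff by blast
    then have "elt (from_nat t @ concat (map from_nat ts)) = t \<otimes>\<^bsub>grp\<^esub> foldr (mult grp) ts \<one>\<^bsub>grp\<^esub>"
      using Cons elt_mult[of "from_nat t" "concat (map from_nat ts)"] by simp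
    then show ?case using Cons C[of t] by simp
  qed (simp add: one_grp)
  have "mnorm R w \<le> C * word_norm grp T (elt w)" for w
  proof -
    obtain ts where ts: "length ts = word_norm grp T (elt w)" "set ts \<subseteq> T'"
      "foldr (mult grp) ts \<one>\<^bsub>grp\<^esub> = elt w"
      using word_norm_witness[of "elt w"] by (auto simp: carrier_grp)
    then have "R (concat (map from_nat ts)) w" using key[OF ts(2)] elt_eq_iff by simp
    then show ?thesis using mnorm_le[of R _ w] key[OF ts(2)] ts(1) by fastforce
  qed
  moreover have "C > 0" by (simp add: C_def)
  ultimately show ?thesis by blast
qed

lemma word_norm_le_mnorm: "\<exists>C>0. \<forall>w. word_norm grp T (elt w) \<le> C * mnorm R w"
proof -
  have "\<exists>ts. set ts \<subseteq> T' \<and> foldr (mult grp) ts \<one>\<^bsub>grp\<^esub> = elt [l]" for l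
    by (rule exists_T_word) (simp add: carrier_grp)
  then obtain t where t: "\<And>l. set (t l) \<subseteq> T'" "\<And>l. foldr (mult grp) (t l) \<one>\<^bsub>grp\<^esub> = elt [l]"
    by metis
  define C where "C = Suc (Max (range (\<lambda>l. length (t l))))"
  have C: "length (t l) \<le> C" for l
    unfolding C_def by (intro le_SucI Max_ge) auto
  have key: "set (concat (map t v)) \<subseteq> T' \<and> foldr (mult grp) (concat (map t v)) \<one>\<^bsub>grp\<^esub> = elt v
      \<and> length (concat (map t v)) \<le> C * length v" for v
  proof (induction v)
    case (Cons l v)
    then show ?case
      using t(1)[of l] foldr_append[of "t l" "concat (map t v)"] C[of l]
      by (simp add: t(2) elt_mult del: foldr_append)
  qed (simp add: one_grp)
  have "word_norm grp T (elt w) \<le> C * mnorm R w" for w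
  proof -
    obtain v where v: "length v = mnorm R w" "R v w" using mnorm_witness[OF M] by blast
    then have "elt v = elt w" using elt_eq_iff by blast
    then show ?thesis using word_norm_le[of "concat (map t v)"] key[of v] v(1) by simp
  qed
  moreover have "C > 0" by (simp add: C_def)
  ultimately show ?thesis by blast
qed

definition normexp :: "nat \<Rightarrow> real" where
  "normexp n = ln (measure_pmf.expectation (rw_law grp law n) (\<lambda>x. real (word_norm grp T x))) / ln (real n)"

lemma normexp_speedexp:
  assumes lamplighter: "\<And>w v. R w v \<Longrightarrow> lamplighter w v" and e: "e > 0"
  shows "\<forall>\<^sub>F n in sequentially. normexp n \<le> speedexp R n + e"
    and "\<forall>\<^sub>F n in sequentially. speedexp R n \<le> normexp n + e"
proof -
  define g where "g n = avg n (\<lambda>w. real (word_norm grp T (elt w)))" for n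
  have normexp: "normexp n = ln (g n) / ln (real n)" for n
    by (simp add: normexp_def rw_law_grp expectation_wpmf g_def)
  obtain C where C: "C > 0" "\<And>w. mnorm R w \<le> C * word_norm grp T (elt w)"
    using mnorm_le_word_norm by blast
  obtain D where D: "D > 0" "\<And>w. word_norm grp T (elt w) \<le> D * mnorm R w"
    using word_norm_le_mnorm by blast
  have sg: "speed R n \<le> real C * g n" for n
    unfolding speed_def g_def avg_cmult[symmetric] of_nat_mult[symmetric]
    by (intro avg_mono) (simp only: of_nat_le_iff C(2))
  have gs: "g n \<le> real D * speed R n" for n
    unfolding speed_def g_def avg_cmult[symmetric] of_nat_mult[symmetric]
    by (intro avg_mono) (simp only: of_nat_le_iff D(2))
  have s: "0 < speed R n" if "n > 0" for n using speed_pos[OF M _ that] lamplighter by blast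
  have g: "0 < g n" if "n > 0" for n
  proof -
    have "0 < real C * g n" using s[OF that] sg[of n] by linarith
    then show ?thesis using C(1) by (simp add: zero_less_mult_iff)
  qed
  show "\<forall>\<^sub>F n in sequentially. normexp n \<le> speedexp R n + e"
    unfolding normexp speedexp_def
    by (rule eventually_ln_comparable[OF _ _ e, of "real D"]) (use D(1) gs g s in auto)
  show "\<forall>\<^sub>F n in sequentially. speedexp R n \<le> normexp n + e"
    unfolding normexp speedexp_def
    by (rule eventually_ln_comparable[OF _ _ e, of "real C"]) (use C(1) sg g s in auto)
qed

end

end

theorem theorem2:
  shows "\<exists>(G :: nat monoid) (\<mu> :: nat pmf).
    group G \<and>
    (\<exists>S. finite S \<and> S \<subseteq> carrier G \<and> generate G S = carrier G) \<and>
    finite (set_pmf \<mu>) \<and> set_pmf \<mu> \<subseteq> carrier G \<and>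
    (\<forall>x\<in>carrier G. pmf \<mu> (inv\<^bsub>G\<^esub> x) = pmf \<mu> x) \<and>
    generate G (set_pmf \<mu>) = carrier G \<and>
    (\<forall>\<^sub>F n in sequentially. 0 < pmf (rw_law G \<mu> n) \<one>\<^bsub>G\<^esub>) \<and>
    (\<forall>T. finite T \<and> T \<subseteq> carrier G \<and> generate G T = carrier G \<longrightarrow>
      liminf (\<lambda>n. ereal (ln \<bar>ln (pmf (rw_law G \<mu> n) \<one>\<^bsub>G\<^esub>)\<bar> / ln (real n))) = ereal (1/3) \<and>
      limsup (\<lambda>n. ereal (ln \<bar>ln (pmf (rw_law G \<mu> n) \<one>\<^bsub>G\<^esub>)\<bar> / ln (real n))) = ereal 1 \<and>
      liminf (\<lambda>n. ereal (ln (measure_pmf.expectation (rw_law G \<mu> n) (\<lambda>x. real (word_norm G T x)))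
                      / ln (real n))) = ereal (1/2) \<and>
      limsup (\<lambda>n. ereal (ln (measure_pmf.expectation (rw_law G \<mu> n) (\<lambda>x. real (word_norm G T x)))
                      / ln (real n))) = ereal 1)"
proof -
  obtain R where M: "marked R" and lamplighter: "\<And>w v. R w v \<Longrightarrow> lamplighter w v"
    and small: "\<And>e N. e > 0 \<Longrightarrow> \<exists>n\<ge>N. retexp R n \<le> 1 / 3 + e \<and> speedexp R n \<le> 1 / 2 + e"
    and large: "\<And>e N. e > 0 \<Longrightarrow> \<exists>n\<ge>N. 1 - e \<le> retexp R n \<and> 1 - e \<le> speedexp R n"
    using exists_oscillating by blast
  let ?G = "grp R" and ?m = "law R"
  have r1: "liminf (\<lambda>n. ereal (retexp R n)) = ereal (1 / 3)"
    by (rule liminf_eqI) (use eventually_retexp_ge[OF M] lamplighter small in blast)+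
  have r2: "limsup (\<lambda>n. ereal (retexp R n)) = ereal 1"
    by (rule limsup_eqI) (use eventually_retexp_le[OF M] lamplighter large in blast)+
  have T: "liminf (\<lambda>n. ereal (normexp R T n)) = ereal (1 / 2) \<and> limsup (\<lambda>n. ereal (normexp R T n)) = ereal 1"
    if T: "finite T" "T \<subseteq> carrier ?G" "generate ?G T = carrier ?G" for T
  proof -
    have ts: "\<forall>\<^sub>F n in sequentially. normexp R T n \<le> speedexp R n + e"
      and st: "\<forall>\<^sub>F n in sequentially. speedexp R n \<le> normexp R T n + e" if "e > 0" for e
      using normexp_speedexp[OF M T _ that] lamplighter by blast+
    show ?thesis
    proof
      show "liminf (\<lambda>n. ereal (normexp R T n)) = ereal (1 / 2)"
      proof (rule liminf_eqI)
        fix e :: real assume "e > 0"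
        \<comment> \<open>Half of the error is spent on the exponent of \<open>speed\<close>, half
          on the change of generating set.\<close>
        then have e: "e / 2 > 0" by simp
        have "\<forall>\<^sub>F n in sequentially. 1 / 2 - e / 2 \<le> speedexp R n"
          by (rule eventually_speedexp_ge[OF M _ e]) (rule lamplighter)
        then show "\<forall>\<^sub>F n in sequentially. 1 / 2 - e \<le> normexp R T n"
          using st[OF e] by eventually_elim simp
        fix N
        obtain N' where N': "\<And>n. n \<ge> N' \<Longrightarrow> normexp R T n \<le> speedexp R n + e / 2"
          using ts[OF e] by (auto simp: eventually_sequentially)
        obtain n where "n \<ge> max N N'" "speedexp R n \<le> 1 / 2 + e / 2"
          using small[OF e, of "max N N'"] by blast
        then show "\<exists>n\<ge>N. normexp R T n \<le> 1 / 2 + e" using N'[of n] by (intro exI[of _ n]) auto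
      qed
      show "limsup (\<lambda>n. ereal (normexp R T n)) = ereal 1"
      proof (rule limsup_eqI)
        fix e :: real assume "e > 0"
        then have e: "e / 2 > 0" by simp
        have "\<forall>\<^sub>F n in sequentially. speedexp R n \<le> 1 + e / 2"
          by (rule eventually_speedexp_le[OF M _ e]) (rule lamplighter)
        then show "\<forall>\<^sub>F n in sequentially. normexp R T n \<le> 1 + e"
          using ts[OF e] by eventually_elim simp
        fix N
        obtain N' where N': "\<And>n. n \<ge> N' \<Longrightarrow> speedexp R n \<le> normexp R T n + e / 2"
          using st[OF e] by (auto simp: eventually_sequentially)
        obtain n where "n \<ge> max N N'" "1 - e / 2 \<le> speedexp R n"
          using large[OF e, of "max N N'"] by blast
        then show "\<exists>n\<ge>N. 1 - e \<le> normexp R T n" using N'[of n] by (intro exI[of _ n]) auto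
      qed
    qed
  qed
  have gen: "finite (set_pmf ?m)" "set_pmf ?m \<subseteq> carrier ?G"
    by (auto simp: set_law[OF M] carrier_grp[OF M])
  show ?thesis
    by (rule exI[of _ ?G], rule exI[of _ ?m])
      (use group_grp[OF M] gen generate_law[OF M] law_symmetric[OF M] r1 r2 T in
        \<open>auto simp: retexp_def[symmetric] normexp_def[OF M, symmetric] pmf_rw_law_one[OF M] ret_pos[OF M]\<close>)
qed

end
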